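(* Let $X$ and $Y$ be perfectly normal Hausdorff spaces, $\mu\in\mathcal{P}_r(X)$, $\nu\in\mathcal{P}_r(Y)$ Radon probability measures, and $c\in lsc_{bi}(X\times Y)$ with $v_{\min}(\mathbf{KP})<+\infty$. Suppose $c(x,y)=\lim_{n\to\infty}c_n(x,y)$ for all $(x,y)\in X\times Y$, where $(c_n)_{n\in\mathbb{N}}$ is a pointwise nondecreasing sequence of bounded non-negative functions $c_n:X\times Y\to\mathbb{R}$ each having property (H). Then $v_{\max}(\mathbf{DP})=v_{\min}(\mathbf{KP})$.
   Context: $C_b(Z)$: real-valued bounded continuous functions on $Z$. $lsc_{bi}(Z)$: proper (not identically $+\infty$), bounded-below, lower semicontinuous $g:Z\to\mathbb{R}\cup\{+\infty\}$. Radon probability measures: Borel probability measures inner regular with respect to compact sets; $\mathcal{P}_r$ denotes them. $(\phi\oplus\psi)(x,y):=\phi(x)+\psi(y)$. $\Pi(\mu,\nu)$: Radon probability measures on $X\times Y$ with marginals $\mu$ and $\nu$; $v_{\min}(\mathbf{KP}):=\inf\{\int c\,d\gamma:\gamma\in\Pi(\mu,\nu)\}$; $v_{\max}(\mathbf{DP}):=\sup\{\int\phi\,d\mu+\int\psi\,d\nu:\phi\in C_b(X),\psi\in C_b(Y),\phi\oplus\psi\le c\}$. For a function $f:X\times Y\to\mathbb{R}$, with $\overline{d}_f(x,x'):=\sup_y|f(x,y)-f(x',y)|$ and $\underline{d}_f(y,y'):=\sup_x|f(x,y)-f(x,y')|$, property (H) means $\lim_{x\to x_0}\overline{d}_f(x,x_0)=0$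 for all $x_0\in X$ and $\lim_{y\to y_0}\underline{d}_f(y,y_0)=0$ for all $y_0\in Y$. *)

theory Defs
  imports "HOL-Analysis.Analysis" "HOL-Probability.Probability"
begin

definition perfectly_normal :: "'a topology \<Rightarrow> bool" where
  "perfectly_normal T \<longleftrightarrow> normal_space T \<and> (\<forall>C. closedin T C \<longrightarrow> gdelta_in T C)"

definition radon_prob :: "'a::topological_space measure \<Rightarrow> bool" where
  "radon_prob M \<longleftrightarrow> prob_space M \<and> sets M = sets borel \<and>
     (\<forall>B\<in>sets M. emeasure M B = (SUP K\<in>{K. compact K \<and> K \<subseteq> B}. emeasure M K))"

definition Cb :: "('a::topological_space \<Rightarrow> real) set" where
  "Cb = {f. continuous_on UNIV f \<and> bounded (range f)}"

definition lsc_bi :: "('a::topological_space \<Rightarrow> ereal) set" where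
  "lsc_bi = {g. (\<exists>z. g z \<noteq> \<infinity>) \<and> (\<exists>m::real. \<forall>z. ereal m \<le> g z) \<and> (\<forall>z. g z \<noteq> -\<infinity>)
               \<and> (\<forall>t::ereal. open {z. t < g z})}"

definition eintegral :: "'a measure \<Rightarrow> ('a \<Rightarrow> ereal) \<Rightarrow> ereal" where
  "eintegral M g = enn2ereal (\<integral>\<^sup>+ z. e2ennreal (g z) \<partial>M) - enn2ereal (\<integral>\<^sup>+ z. e2ennreal (- g z) \<partial>M)"

definition couplings :: "'a::topological_space measure \<Rightarrow> 'b::topological_space measure \<Rightarrow> ('a \<times> 'b) measure set" where
  "couplings \<mu> \<nu> = {\<gamma>. radon_prob \<gamma> \<and> distr \<gamma> borel fst = \<mu> \<and> distr \<gamma> borel snd = \<nu>}"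

definition vmin_KP :: "'a::topological_space measure \<Rightarrow> 'b::topological_space measure \<Rightarrow> ('a \<times> 'b \<Rightarrow> ereal) \<Rightarrow> ereal" where
  "vmin_KP \<mu> \<nu> c = (INF \<gamma>\<in>couplings \<mu> \<nu>. eintegral \<gamma> c)"

definition vmax_DP :: "'a::topological_space measure \<Rightarrow> 'b::topological_space measure \<Rightarrow> ('a \<times> 'b \<Rightarrow> ereal) \<Rightarrow> ereal" where
  "vmax_DP \<mu> \<nu> c = Sup {ereal ((\<integral>x. \<phi> x \<partial>\<mu>) + (\<integral>y. \<psi> y \<partial>\<nu>)) | \<phi> \<psi>.
       \<phi> \<in> Cb \<and> \<psi> \<in> Cb \<and> (\<forall>x y. ereal (\<phi> x + \<psi> y) \<le> c (x, y))}"

definition dbar :: "('a \<times> 'b \<Rightarrow> real) \<Rightarrow> 'a \<Rightarrow> 'a \<Rightarrow> ereal" where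
  "dbar f x x' = (SUP y. ereal \<bar>f (x, y) - f (x', y)\<bar>)"

definition dund :: "('a \<times> 'b \<Rightarrow> real) \<Rightarrow> 'b \<Rightarrow> 'b \<Rightarrow> ereal" where
  "dund f y y' = (SUP x. ereal \<bar>f (x, y) - f (x, y')\<bar>)"

definition property_H :: "('a::topological_space \<times> 'b::topological_space \<Rightarrow> real) \<Rightarrow> bool" where
  "property_H f \<longleftrightarrow> (\<forall>x0. ((\<lambda>x. dbar f x x0) \<longlongrightarrow> 0) (at x0))
                  \<and> (\<forall>y0. ((\<lambda>y. dund f y y0) \<longlongrightarrow> 0) (at y0))"

end

theory Submission
  imports Defs
begin

text \<open>
  Let \<open>V\<close> be the dual value. On bounded continuous functions of two variables,
  \<open>p h = inf {\<integral>\<phi> d\<mu> + \<integral>\<psi> d\<nu> + t V | h \<le> \<phi> \<oplus> \<psi> + t c\<^sub>n, t \<ge> 0}\<close> is finite and sublinear precisely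
  because \<open>V\<close> bounds the dual problem of every \<open>c\<^sub>n\<close>. A linear functional \<open>L \<le> p\<close>, given by
  Hahn--Banach, is positive, has the prescribed marginals, and satisfies \<open>L c\<^sub>n \<le> V\<close> for all \<open>n\<close>.
  Tightness of the marginals passes to \<open>L\<close>, which therefore comes from a Radon probability
  measure \<open>\<gamma>\<close>; only \<open>\<integral>f d\<gamma> \<le> L f\<close> for \<open>f \<ge> 0\<close> is needed. Then \<open>\<gamma>\<close> is a coupling with \<open>\<integral>c d\<gamma> \<le> V\<close> by monotone
  convergence. Property (H) enters only through the joint continuity of \<open>c\<^sub>n\<close>.
\<close>

subsection \<open>A Hahn--Banach theorem\<close>

text \<open>Without compactness, a positive functional on the bounded continuous functions may be
  only finitely additive: mass can escape to infinity. Inner regularity of the marginals excludes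
  this. A second obstacle is that a product of two normal spaces need not be normal. Urysohn
  functions are available on the factors, but on the product there is only complete regularity. The
  representation of \<open>L\<close> therefore separates points, not closed sets, from closed sets,
  and everything specific to the product is tested through sums of functions of one variable.

  The variable \<open>t\<close> in \<open>p\<close> acts as a multiplier for the cost constraint:
  \<open>t = 0\<close> encodes positivity and the marginals, and \<open>t = 1\<close> with zero
  potentials encodes the bound by \<open>V\<close>. Because one infimum admits every index
  \<open>n\<close>, a single coupling serves all the costs at once and no limit of couplings is
  taken. That \<open>V\<close> bounds the dual problem of each \<open>cn n\<close> comes from
  \<open>cn n\<close> lying below \<open>c\<close>, so that potentials for \<open>cn n\<close> are
  also potentials for \<open>c\<close>.\<close>

definition sublinear :: "('v::real_vector \<Rightarrow> real) \<Rightarrow> bool" where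
  "sublinear p \<longleftrightarrow> (\<forall>x y. p (x + y) \<le> p x + p y) \<and> (\<forall>t\<ge>0. \<forall>x. p (t *\<^sub>R x) = t * p x)"

lemma sublinear_add: "sublinear p \<Longrightarrow> p (x + y) \<le> p x + p y"
  by (simp add: sublinear_def)

lemma sublinear_scale: "sublinear p \<Longrightarrow> 0 \<le> t \<Longrightarrow> p (t *\<^sub>R x) = t * p x"
  by (simp add: sublinear_def)

lemma sublinear_zero: "sublinear p \<Longrightarrow> p 0 = 0"
  using sublinear_scale[of p 0 0] by simp

lemma sublinear_ge_minus: "sublinear p \<Longrightarrow> - p (- x) \<le> p x"
  using sublinear_add[of p x "- x"] sublinear_zero[of p] by simp

text \<open>Applying the inequality for \<open>t\<close> and for \<open>inverse t\<close> gives
  equality, so only one direction of homogeneity has to be checked.\<close>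

lemma sublinearI:
  assumes add: "\<And>x y. p (x + y) \<le> p x + p y"
    and scale: "\<And>t x. 0 < t \<Longrightarrow> p (t *\<^sub>R x) \<le> t * p x"
    and zero: "p 0 = 0"
  shows "sublinear p"
  unfolding sublinear_def
proof (intro conjI allI impI)
  fix x y show "p (x + y) \<le> p x + p y" by (rule add)
next
  fix t :: real and x assume "0 \<le> t"
  show "p (t *\<^sub>R x) = t * p x"
  proof (cases "t = 0")
    case False
    with \<open>0 \<le> t\<close> have t: "0 < t" by simp
    have "p x \<le> inverse t * p (t *\<^sub>R x)"
      using scale[of "inverse t" "t *\<^sub>R x"] t by simp
    then have "t * p x \<le> p (t *\<^sub>R x)"
      using t by (simp add: field_simps)
    with scale[OF t, of x] show ?thesis by simp
  qed (simp add: zero)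
qed

text \<open>Each member satisfies \<open>q x \<ge> - q (- x) \<ge> - p (- x)\<close>, so the infimum
  is finite. Subadditivity is where the chain matters: a bound by \<open>q x + r y\<close> needs one
  member below both \<open>q\<close> and \<open>r\<close>.\<close>

lemma sublinear_Inf_chain:
  fixes p :: "'v::real_vector \<Rightarrow> real"
  assumes p: "sublinear p" and ne: "C \<noteq> {}"
    and C: "\<And>q. q \<in> C \<Longrightarrow> sublinear q \<and> q \<le> p"
    and chain: "\<And>q r. q \<in> C \<Longrightarrow> r \<in> C \<Longrightarrow> q \<le> r \<or> r \<le> q"
  shows "sublinear (\<lambda>x. INF q\<in>C. q x)" and "\<And>q x. q \<in> C \<Longrightarrow> (INF q\<in>C. q x) \<le> q x"
proof -
  have "- p (- x) \<le> q x" if "q \<in> C" for q x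
    using sublinear_ge_minus[of q x] C[OF that] by (auto simp: le_fun_def intro: order_trans[rotated])
  then have bdd: "bdd_below ((\<lambda>q. q x) ` C)" for x
    by (auto intro!: bdd_belowI2)
  show lower: "(INF q\<in>C. q x) \<le> q x" if "q \<in> C" for q x
    by (rule cINF_lower[OF bdd that])
  show "sublinear (\<lambda>x. INF q\<in>C. q x)"
  proof (rule sublinearI)
    fix x y
    have "(INF q\<in>C. q (x + y)) \<le> q x + r y" if qr: "q \<in> C" "r \<in> C" for q r
    proof -
      from chain[OF qr] obtain s where s: "s \<in> C" "s \<le> q" "s \<le> r"
        using qr by blast
      have "(INF q\<in>C. q (x + y)) \<le> s (x + y)" by (rule lower[OF s(1)])
      also have "\<dots> \<le> s x + s y" using C[OF s(1)] sublinear_add by blast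
      also have "\<dots> \<le> q x + r y" using s by (auto simp: le_fun_def intro: add_mono)
      finally show ?thesis .
    qed
    then have "(INF q\<in>C. q (x + y)) - r y \<le> (INF q\<in>C. q x)" if "r \<in> C" for r
      using that by (intro cINF_greatest[OF ne]) (simp add: diff_le_eq)
    then have "(INF q\<in>C. q (x + y)) - (INF q\<in>C. q x) \<le> (INF q\<in>C. q y)"
      by (intro cINF_greatest[OF ne]) (simp add: algebra_simps)
    then show "(INF q\<in>C. q (x + y)) \<le> (INF q\<in>C. q x) + (INF q\<in>C. q y)"
      by simp
  next
    fix t :: real and x assume t: "0 < t"
    have "(INF q\<in>C. q (t *\<^sub>R x)) / t \<le> (INF q\<in>C. q x)"
    proof (rule cINF_greatest[OF ne])
      fix q assume q: "q \<in> C"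
      have "(INF q\<in>C. q (t *\<^sub>R x)) \<le> t * q x"
        using lower[OF q, of "t *\<^sub>R x"] C[OF q] t by (simp add: sublinear_scale)
      then show "(INF q\<in>C. q (t *\<^sub>R x)) / t \<le> q x"
        using t by (simp add: field_simps)
    qed
    then show "(INF q\<in>C. q (t *\<^sub>R x)) \<le> t * (INF q\<in>C. q x)"
      using t by (simp add: field_simps)
  next
    have "(\<lambda>q. q 0) ` C = {0}"
      using C ne sublinear_zero by force
    then show "(INF q\<in>C. q 0) = 0" by simp
  qed
qed

text \<open>For every direction \<open>v\<close> there is a sublinear \<open>q \<le> p\<close> with
  \<open>q x \<le> p (x + v) - p v\<close>. Minimality forces \<open>q = p\<close>, so
  \<open>p\<close> is superadditive as well as subadditive.\<close>

lemma minimal_sublinear_imp_linear: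
  fixes p :: "'v::real_vector \<Rightarrow> real"
  assumes p: "sublinear p" and min: "\<And>q. sublinear q \<Longrightarrow> q \<le> p \<Longrightarrow> q = p"
  shows "linear p"
proof -
  have sup: "p x + p v \<le> p (x + v)" for x v
  proof -
    \<comment> \<open>A linear \<open>f \<le> p\<close> with \<open>f v = p v\<close> satisfies
      \<open>f x = f (x + t *\<^sub>R v) - t * p v\<close>, hence lies below this \<open>q\<close>:
      the formula is the upper bound that such an \<open>f\<close> must obey.\<close>
    define q where "q x = (INF t\<in>{0..}. p (x + t *\<^sub>R v) - t * p v)" for x
    have "- p (- x) \<le> p (x + t *\<^sub>R v) - t * p v" if "0 \<le> t" for t x
      using sublinear_add[OF p, of "x + t *\<^sub>R v" "- x"] sublinear_scale[OF p that, of v] by simp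
    then have bdd: "bdd_below ((\<lambda>t. p (x + t *\<^sub>R v) - t * p v) ` {0..})" for x
      by (auto intro!: bdd_belowI2)
    have lower: "q x \<le> p (x + t *\<^sub>R v) - t * p v" if "0 \<le> t" for t x
      unfolding q_def using that by (intro cINF_lower[OF bdd]) auto
    have great: "a \<le> q x" if "\<And>t. 0 \<le> t \<Longrightarrow> a \<le> p (x + t *\<^sub>R v) - t * p v" for a x
      unfolding q_def using that by (intro cINF_greatest) auto
    have "sublinear q"
    proof (rule sublinearI)
      fix x y
      have "q (x + y) \<le> (p (x + t *\<^sub>R v) - t * p v) + (p (y + s *\<^sub>R v) - s * p v)"
        if "0 \<le> t" "0 \<le> s" for s t
        using lower[of "t + s" "x + y"] that sublinear_add[OF p, of "x + t *\<^sub>R v" "y + s *\<^sub>R v"]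
        by (simp add: algebra_simps)
      then have "q (x + y) - (p (y + s *\<^sub>R v) - s * p v) \<le> q x" if "0 \<le> s" for s
        using that by (intro great) (simp add: diff_le_eq)
      then have "q (x + y) - q x \<le> q y"
        by (intro great) (simp add: algebra_simps)
      then show "q (x + y) \<le> q x + q y" by simp
    next
      fix r :: real and x assume r: "0 < r"
      have "q (r *\<^sub>R x) / r \<le> q x"
      proof (rule great)
        fix t :: real assume t: "0 \<le> t"
        have "q (r *\<^sub>R x) \<le> p (r *\<^sub>R (x + t *\<^sub>R v)) - r * t * p v"
          using lower[of "r * t" "r *\<^sub>R x"] r t by (simp add: algebra_simps)
        also have "\<dots> = r * (p (x + t *\<^sub>R v) - t * p v)"
          using sublinear_scale[OF p, of r "x + t *\<^sub>R v"] r by (simp add: right_diff_distrib)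
        finally show "q (r *\<^sub>R x) / r \<le> p (x + t *\<^sub>R v) - t * p v"
          using r by (simp add: field_simps)
      qed
      then show "q (r *\<^sub>R x) \<le> r * q x" using r by (simp add: field_simps)
    next
      have "q 0 \<le> 0" using lower[of 0 0] sublinear_zero[OF p] by simp
      moreover have "0 \<le> q 0"
        using sublinear_scale[OF p, of _ v] by (intro great) simp
      ultimately show "q 0 = 0" by simp
    qed
    moreover have "q \<le> p"
      using lower[of 0] by (simp add: le_fun_def)
    ultimately have "q = p" by (rule min)
    then show ?thesis using lower[of 1 x] by simp
  qed
  have add: "p (x + y) = p x + p y" for x y
    using sup[of x y] sublinear_add[OF p, of x y] by simp
  have neg: "p (- x) = - p x" for x
    using add[of x "- x"] sublinear_zero[OF p] by simp
  have "p (r *\<^sub>R x) = r *\<^sub>R p x" for r x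
  proof (cases "0 \<le> r")
    case False
    then show ?thesis
      using sublinear_scale[OF p, of "- r" x] neg[of "r *\<^sub>R x"] by simp
  qed (simp add: sublinear_scale[OF p])
  with add show ?thesis by (auto intro: linearI)
qed

text \<open>Stated without a subspace to extend from, since all constraints on the functional will
  be encoded in \<open>p\<close>. A minimal sublinear functional below \<open>p\<close> exists by
  Zorn's lemma and is linear.\<close>

theorem Hahn_Banach_sublinear:
  fixes p :: "'v::real_vector \<Rightarrow> real"
  assumes p: "sublinear p"
  obtains f where "linear f" "f \<le> p"
proof -
  define A where "A = {q. sublinear q \<and> q \<le> p}"
  \<comment> \<open>Zorn's lemma is used for the reversed order, so its maximal element is a minimal
    sublinear functional.\<close>
  have "\<exists>m\<in>A. \<forall>a\<in>A. m \<ge> a \<longrightarrow> a = m"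
  proof (rule predicate_Zorn)
    show "partial_order_on A (relation_of (\<ge>) A)"
      by (rule partial_order_on_relation_ofI) auto
  next
    fix C assume C: "C \<in> Chains (relation_of (\<ge>) A)"
    show "\<exists>u\<in>A. \<forall>a\<in>C. a \<ge> u"
    proof (cases "C = {}")
      case True
      then show ?thesis using p by (auto simp: A_def)
    next
      case False
      have CA: "sublinear q \<and> q \<le> p" if "q \<in> C" for q
        using C that by (auto simp: Chains_def relation_of_def A_def)
      have chain: "q \<le> r \<or> r \<le> q" if "q \<in> C" "r \<in> C" for q r
        using C that by (auto simp: Chains_def relation_of_def)
      have inf: "sublinear (\<lambda>x. INF q\<in>C. q x)" "\<And>q x. q \<in> C \<Longrightarrow> (INF q\<in>C. q x) \<le> q x"
        using sublinear_Inf_chain[OF p False CA chain] by blast+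
      from False obtain q where q: "q \<in> C" by blast
      have "(\<lambda>x. INF q\<in>C. q x) \<le> p"
        using inf(2)[OF q] CA[OF q] by (auto simp: le_fun_def intro: order_trans)
      with inf show ?thesis
        by (intro bexI[of _ "\<lambda>x. INF q\<in>C. q x"]) (auto simp: A_def le_fun_def)
    qed
  qed
  then obtain m where m: "sublinear m" "m \<le> p"
    and min: "\<And>q. sublinear q \<Longrightarrow> q \<le> p \<Longrightarrow> q \<le> m \<Longrightarrow> q = m"
    unfolding A_def by auto
  have "linear m"
    using m by (intro minimal_sublinear_imp_linear min) auto
  then show ?thesis using m that by blast
qed

subsection \<open>Bounded continuous functions\<close>

lemma CbI: "continuous_on UNIV f \<Longrightarrow> (\<And>x. \<bar>f x\<bar> \<le> B) \<Longrightarrow> f \<in> Cb"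
  by (auto simp: Cb_def bounded_iff)

lemma CbE:
  assumes "f \<in> Cb"
  obtains B where "0 \<le> B" "continuous_on UNIV f" "\<And>x. \<bar>f x\<bar> \<le> B"
  using assms by (auto simp: Cb_def bounded_iff) (meson abs_ge_zero order_trans)

lemma Cb_continuous: "f \<in> Cb \<Longrightarrow> continuous_on UNIV f"
  by (simp add: Cb_def)

lemma Cb_const: "(\<lambda>_. a) \<in> Cb"
  by (rule CbI[of _ "\<bar>a\<bar>"]) auto

lemma Cb_add:
  assumes "f \<in> Cb" "g \<in> Cb" shows "(\<lambda>x. f x + g x) \<in> Cb"
proof -
  from assms obtain A B where "\<And>x. \<bar>f x\<bar> \<le> A" "\<And>x. \<bar>g x\<bar> \<le> B" by (metis CbE)
  then have "\<bar>f x + g x\<bar> \<le> A + B" for x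
    by (meson abs_triangle_ineq add_mono order_trans)
  then show ?thesis using assms by (intro CbI continuous_intros) (auto simp: Cb_def)
qed

lemma Cb_cmult:
  assumes "f \<in> Cb" shows "(\<lambda>x. a * f x) \<in> Cb"
proof -
  from assms obtain A where "\<And>x. \<bar>f x\<bar> \<le> A" by (metis CbE)
  then have "\<bar>a * f x\<bar> \<le> \<bar>a\<bar> * A" for x
    by (simp add: abs_mult mult_left_mono)
  then show ?thesis using assms by (intro CbI continuous_intros) (auto simp: Cb_def)
qed

lemma Cb_uminus: "f \<in> Cb \<Longrightarrow> (\<lambda>x. - f x) \<in> Cb"
  using Cb_cmult[of f "-1"] by simp

lemma Cb_diff: "f \<in> Cb \<Longrightarrow> g \<in> Cb \<Longrightarrow> (\<lambda>x. f x - g x) \<in> Cb"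
  using Cb_add[OF _ Cb_uminus, of f g] by simp

lemma Cb_sum: "(\<And>i. i \<in> I \<Longrightarrow> f i \<in> Cb) \<Longrightarrow> (\<lambda>x. \<Sum>i\<in>I. f i x) \<in> Cb"
  by (induction I rule: infinite_finite_induct) (auto intro: Cb_const Cb_add)

lemma Cb_min:
  assumes "f \<in> Cb" "g \<in> Cb" shows "(\<lambda>x. min (f x) (g x)) \<in> Cb"
proof -
  from assms obtain A B where "\<And>x. \<bar>f x\<bar> \<le> A" "\<And>x. \<bar>g x\<bar> \<le> B" by (metis CbE)
  then have "\<bar>min (f x) (g x)\<bar> \<le> A + B" for x
    by (smt (verit) min_def)
  then show ?thesis using assms by (intro CbI continuous_intros) (auto simp: Cb_def)
qed

lemma Cb_max: "f \<in> Cb \<Longrightarrow> g \<in> Cb \<Longrightarrow> (\<lambda>x. max (f x) (g x)) \<in> Cb"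
  using Cb_uminus[OF Cb_min[OF Cb_uminus Cb_uminus, of f g]]
  by (simp add: minus_min_eq_max)

lemma Cb_comp:
  assumes "f \<in> Cb" "continuous_on UNIV h" shows "(\<lambda>x. f (h x)) \<in> Cb"
proof -
  have "continuous_on UNIV (\<lambda>x. f (h x))"
    by (rule continuous_on_compose2[OF Cb_continuous[OF assms(1)] assms(2)]) auto
  with assms show ?thesis
    by (elim CbE) (rule CbI)
qed

lemmas Cb_intros = Cb_const Cb_add Cb_cmult Cb_uminus Cb_diff Cb_sum Cb_min Cb_max

lemma Cb_borel_measurable:
  assumes "f \<in> Cb" "sets M = sets borel" shows "f \<in> borel_measurable M"
  using borel_measurable_continuous_onI[OF Cb_continuous[OF assms(1)]] assms(2)
  by (metis measurable_cong_sets)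

lemma Cb_integrable:
  assumes "f \<in> Cb" "finite_measure M" "sets M = sets borel" shows "integrable M f"
proof -
  interpret finite_measure M by fact
  from assms obtain B where "\<And>x. \<bar>f x\<bar> \<le> B" by (metis CbE)
  then show ?thesis
    using Cb_borel_measurable[OF assms(1,3)] by (intro integrable_const_bound[of _ B]) auto
qed

subsection \<open>Riesz representation of tight functionals\<close>

text \<open>Only the values of \<open>L\<close> on \<open>Cb\<close> are constrained, so plain
  functions can be used as arguments. The test functions in \<open>tight\<close> are bounded above
  but not below by a fixed constant, which lets the condition apply directly to differences. The
  last two assumptions hold in completely regular Hausdorff spaces; they appear as assumptions
  because the type class carries no separation axiom.\<close>

locale tight_functional =
  fixes L :: "('z::topological_space \<Rightarrow> real) \<Rightarrow> real"
  assumes add: "f \<in> Cb \<Longrightarrow> g \<in> Cb \<Longrightarrow> L (\<lambda>x. f x + g x) = L f + L g"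
    and cmult: "f \<in> Cb \<Longrightarrow> L (\<lambda>x. a * f x) = a * L f"
    and mono: "f \<in> Cb \<Longrightarrow> g \<in> Cb \<Longrightarrow> (\<And>x. f x \<le> g x) \<Longrightarrow> L f \<le> L g"
    and one: "L (\<lambda>_. 1) = 1"
    and tight: "0 < e \<Longrightarrow>
      \<exists>K. compact K \<and> (\<forall>f\<in>Cb. (\<forall>x\<in>K. f x \<le> 0) \<longrightarrow> (\<forall>x. f x \<le> 1) \<longrightarrow> L f \<le> e)"
    and compact_closed: "compact (K::'z set) \<Longrightarrow> closed K"
    and separation: "open U \<Longrightarrow> z \<in> U \<Longrightarrow>
      \<exists>f\<in>Cb. f z = 1 \<and> (\<forall>x. 0 \<le> f x \<and> f x \<le> indicator U (x::'z))"
begin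

text \<open>There is no support condition: a member may stay positive up to the boundary of
  \<open>U\<close>.\<close>

definition below :: "'z set \<Rightarrow> ('z \<Rightarrow> real) set" where
  "below U = {f \<in> Cb. \<forall>x. 0 \<le> f x \<and> f x \<le> indicator U x}"

text \<open>This value is forced: the indicator of \<open>U\<close> is the supremum of the upward
  directed family \<open>below U\<close>, so a Radon measure representing \<open>L\<close> has to
  take it on \<open>U\<close>.\<close>

definition open_content :: "'z set \<Rightarrow> ennreal" where
  "open_content U = (SUP f\<in>below U. ennreal (L f))"

definition outer_content :: "'z set \<Rightarrow> ennreal" where
  "outer_content A = (INF U\<in>{U. open U \<and> A \<subseteq> U}. open_content U)"

section \<open>Elementary properties of the functional and of the content on open sets\<close>

lemma const: "L (\<lambda>_. a) = a"
  using cmult[OF Cb_const, of a 1] one by simp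

lemma diff: "f \<in> Cb \<Longrightarrow> g \<in> Cb \<Longrightarrow> L (\<lambda>x. f x - g x) = L f - L g"
  using add[OF _ Cb_uminus, of f g] cmult[of g "-1"] by simp

lemma sum: "(\<And>i. i \<in> I \<Longrightarrow> f i \<in> Cb) \<Longrightarrow> L (\<lambda>x. \<Sum>i\<in>I. f i x) = (\<Sum>i\<in>I. L (f i))"
  by (induction I rule: infinite_finite_induct) (auto simp: const add Cb_sum)

lemma nonneg: "f \<in> Cb \<Longrightarrow> (\<And>x. 0 \<le> f x) \<Longrightarrow> 0 \<le> L f"
  using mono[OF Cb_const, of f 0] const by simp

lemma tightE:
  assumes "0 < e"
  obtains K where "compact K"
    "\<And>f. f \<in> Cb \<Longrightarrow> \<forall>x\<in>K. f x \<le> 0 \<Longrightarrow> \<forall>x. f x \<le> 1 \<Longrightarrow> L f \<le> e"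
  using tight[OF assms] by blast

lemma belowD:
  assumes "f \<in> below U"
  shows "f \<in> Cb" "0 \<le> f x" "f x \<le> 1" "x \<notin> U \<Longrightarrow> f x = 0"
proof -
  have f: "f \<in> Cb" "\<And>x. 0 \<le> f x" "\<And>x. f x \<le> indicator U x"
    using assms by (simp_all add: below_def)
  show "f \<in> Cb" "0 \<le> f x" by (fact f)+
  show "f x \<le> 1" using f(3) indicator_le_1 by (rule order_trans)
  show "f x = 0" if "x \<notin> U" using f(2,3)[of x] that by simp
qed

lemma belowI:
  assumes "f \<in> Cb" "\<And>x. 0 \<le> f x" "\<And>x. f x \<le> 1" "\<And>x. x \<notin> U \<Longrightarrow> f x = 0"
  shows "f \<in> below U"
  using assms unfolding below_def by (auto simp: indicator_def)

lemma below_zero: "(\<lambda>_. 0) \<in> below U"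
  by (rule belowI) (auto intro: Cb_const)

lemma open_content_upper: "f \<in> below U \<Longrightarrow> ennreal (L f) \<le> open_content U"
  unfolding open_content_def by (rule SUP_upper)

lemma open_content_mono: "U \<subseteq> V \<Longrightarrow> open_content U \<le> open_content V"
proof -
  assume "U \<subseteq> V"
  then have "indicator U x \<le> (indicator V x :: real)" for x by (auto simp: indicator_def)
  then have "below U \<subseteq> below V" unfolding below_def using order_trans by blast
  then show ?thesis unfolding open_content_def by (rule SUP_subset_mono) simp
qed

lemma open_content_empty: "open_content {} = 0"
proof -
  have "f = (\<lambda>_. 0)" if "f \<in> below {}" for f
    using belowD(4)[OF that] by auto
  then have "below {} = {\<lambda>_. 0}" using below_zero by blast
  then show ?thesis by (simp add: open_content_def const)
qed

lemma open_content_UNIV: "open_content UNIV = 1"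
proof (rule antisym)
  have "L f \<le> 1" if "f \<in> below UNIV" for f
    using mono[OF belowD(1)[OF that] Cb_const, of 1] belowD(3)[OF that] one by simp
  then show "open_content UNIV \<le> 1"
    unfolding open_content_def by (intro SUP_least) simp
  have "(\<lambda>_. 1) \<in> below UNIV" by (rule belowI) (auto intro: Cb_const)
  from open_content_upper[OF this] show "1 \<le> open_content UNIV" by (simp add: one)
qed

text \<open>Tightness replaces compactness of the support in the usual argument: off a compact set,
  \<open>L\<close> loses at most \<open>e/2\<close>, and on it finitely many test functions below the \<open>U i\<close> dominate \<open>f - e/2\<close>.\<close>

lemma open_content_UN:
  assumes U: "\<And>i::nat. open (U i)"
  shows "open_content (\<Union>i. U i) \<le> (\<Sum>i. open_content (U i))"
  unfolding open_content_def[of "\<Union>i. U i"]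
proof (rule SUP_least, rule ennreal_le_epsilon)
  fix f and e :: real assume f: "f \<in> below (\<Union>i. U i)" and e: "0 < e"
  obtain K where K: "compact K"
    and KL: "\<And>h. h \<in> Cb \<Longrightarrow> \<forall>x\<in>K. h x \<le> 0 \<Longrightarrow> \<forall>x. h x \<le> 1 \<Longrightarrow> L h \<le> e/2"
    using tightE[of "e/2"] e by (metis half_gt_zero)
  \<comment> \<open>Where \<open>f z = 0\<close> the zero function will do, thanks to the slack
    \<open>e/2\<close>; elsewhere \<open>z\<close> lies in some \<open>U i\<close>, and point
    separation gives \<open>h z = 1 \<ge> f z\<close>.\<close>
  have "\<exists>i h. h \<in> below (U i) \<and> f z < h z + e/2" for z
  proof (cases "f z = 0")
    case True
    then show ?thesis using below_zero e by force
  next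
    case False
    then obtain i where "z \<in> U i" using belowD(4)[OF f] by blast
    then obtain h where "h \<in> below (U i)" "h z = 1"
      using separation[OF U] unfolding below_def by blast
    moreover have "f z < 1 + e/2" using belowD(3)[OF f, of z] e by simp
    ultimately show ?thesis by force
  qed
  then obtain i h where h: "\<And>z. h z \<in> below (U (i z))" and fh: "\<And>z. f z < h z z + e/2"
    by metis
  define W where "W z = {x. f x < h z x + e/2}" for z
  have "open (W z)" for z
    unfolding W_def using belowD(1)[OF f] belowD(1)[OF h]
    by (intro open_Collect_less continuous_intros Cb_continuous)
  moreover have "K \<subseteq> (\<Union>z\<in>K. W z)"
    using fh by (auto simp: W_def)
  ultimately obtain T where T: "finite T" "K \<subseteq> (\<Union>z\<in>T. W z)"
    using compactE_image[OF K, of K W] by metis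
  \<comment> \<open>The chosen functions are grouped by the index of their open set. Truncation at 1
    keeps the sum in \<open>below (U j)\<close> and loses nothing in \<open>hg\<close>, because each
    single \<open>h z\<close> is at most 1.\<close>
  define g where "g j x = min 1 (\<Sum>z\<in>{z\<in>T. i z = j}. h z x)" for j x
  have g: "g j \<in> below (U j)" for j
  proof (rule belowI)
    show "g j \<in> Cb"
      unfolding g_def using belowD(1)[OF h] by (intro Cb_intros)
    show "0 \<le> g j x" "g j x \<le> 1" for x
      unfolding g_def using belowD(2)[OF h] by (auto intro: sum_nonneg)
    show "g j x = 0" if "x \<notin> U j" for x
    proof -
      have "(\<Sum>z\<in>{z\<in>T. i z = j}. h z x) = 0"
        using belowD(4)[OF h] that by (intro sum.neutral) auto
      then show ?thesis by (simp add: g_def)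
    qed
  qed
  have hg: "h z x \<le> (\<Sum>j\<in>i ` T. g j x)" if "z \<in> T" for z x
  proof -
    have "h z x \<le> (\<Sum>z\<in>{z'\<in>T. i z' = i z}. h z x)"
      using that T(1) belowD(2)[OF h] by (intro member_le_sum) auto
    then have "h z x \<le> g (i z) x"
      using belowD(3)[OF h] by (simp add: g_def)
    also have "\<dots> \<le> (\<Sum>j\<in>i ` T. g j x)"
      using that T(1) belowD(2)[OF g] by (intro member_le_sum) auto
    finally show ?thesis .
  qed
  \<comment> \<open>The remainder is nonpositive on \<open>K\<close> by the choice of the cover and
    at most 1 everywhere, so tightness gives \<open>L r \<le> e/2\<close>; the subtracted
    \<open>e/2\<close> accounts for the other half of \<open>e\<close>.\<close>
  define r where "r x = f x - (\<Sum>j\<in>i ` T. g j x) - e/2" for x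
  note Cbs = belowD(1)[OF f] belowD(1)[OF g]
  have "L r \<le> e/2"
  proof (rule KL)
    show "r \<in> Cb" unfolding r_def by (intro Cb_intros Cbs)
    show "\<forall>x\<in>K. r x \<le> 0"
    proof
      fix x assume "x \<in> K"
      then obtain z where "z \<in> T" "f x < h z x + e/2" using T by (auto simp: W_def)
      with hg[of z x] show "r x \<le> 0" by (simp add: r_def)
    qed
    have "0 \<le> (\<Sum>j\<in>i ` T. g j x)" for x
      using belowD(2)[OF g] by (intro sum_nonneg)
    then show "\<forall>x. r x \<le> 1"
      using belowD(3)[OF f] e unfolding r_def by (smt (verit) divide_pos_pos)
  qed
  moreover have "L r = L f - (\<Sum>j\<in>i ` T. L (g j)) - e/2"
    unfolding r_def by (simp add: diff Cb_intros Cbs sum const)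
  ultimately have "L f \<le> (\<Sum>j\<in>i ` T. L (g j)) + e" by simp
  then have "ennreal (L f) \<le> (\<Sum>j\<in>i ` T. ennreal (L (g j))) + ennreal e"
    using e nonneg[OF belowD(1)[OF g] belowD(2)[OF g]]
    by (subst sum_ennreal) (auto simp flip: ennreal_plus simp: sum_nonneg intro!: ennreal_leI)
  also have "(\<Sum>j\<in>i ` T. ennreal (L (g j))) \<le> (\<Sum>j\<in>i ` T. open_content (U j))"
    by (intro sum_mono open_content_upper g)
  also have "\<dots> \<le> (\<Sum>j. open_content (U j))"
    using T(1) by (intro sum_le_suminf) auto
  finally show "ennreal (L f) \<le> (\<Sum>j. open_content (U j)) + ennreal e"
    by (simp add: add_mono)
qed

section \<open>The induced outer measure and its measurable sets\<close>

lemma outer_content_open: "open U \<Longrightarrow> outer_content U = open_content U"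
  unfolding outer_content_def
  by (rule antisym) (auto intro!: INF_lower INF_greatest open_content_mono)

lemma outer_content_mono: "A \<subseteq> B \<Longrightarrow> outer_content A \<le> outer_content B"
  unfolding outer_content_def by (rule INF_superset_mono) auto

lemma outer_content_le: "open U \<Longrightarrow> A \<subseteq> U \<Longrightarrow> outer_content A \<le> open_content U"
  unfolding outer_content_def by (rule INF_lower) auto

lemma outer_content_approx:
  assumes "0 < (e::real)"
  obtains U where "open U" "A \<subseteq> U" "open_content U \<le> outer_content A + ennreal e"
proof -
  have "outer_content A \<le> 1"
    using outer_content_le[of UNIV A] open_content_UNIV by simp
  then have "outer_content A \<noteq> \<infinity>" by (auto simp: top_unique)
  from INF_approx_ennreal[OF _ _ this, of e open_content "{U. open U \<and> A \<subseteq> U}"]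
  show ?thesis using assms that by (auto simp: outer_content_def less_imp_le)
qed

lemma outer_measure_space_outer_content: "outer_measure_space (Pow UNIV) outer_content"
  unfolding outer_measure_space_def
proof (intro conjI)
  show "positive (Pow UNIV) outer_content"
    by (simp add: positive_def outer_content_open open_content_empty)
  show "increasing (Pow UNIV) outer_content"
    by (simp add: increasing_def outer_content_mono)
  show "countably_subadditive (Pow UNIV) outer_content"
    unfolding countably_subadditive_def
  proof (intro allI impI, rule ennreal_le_epsilon)
    fix A :: "nat \<Rightarrow> 'z set" and e :: real assume e: "0 < e"
    \<comment> \<open>The exponent \<open>Suc i\<close> makes the errors sum to exactly
      \<open>e\<close>.\<close>
    have "\<exists>U. open U \<and> A i \<subseteq> U \<and> open_content U \<le> outer_content (A i) + ennreal (e * (1/2)^Suc i)" for i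
    proof -
      have "0 < e * (1/2)^Suc i" using e by simp
      then show ?thesis using outer_content_approx by metis
    qed
    then obtain U where U: "\<And>i. open (U i)" "\<And>i. A i \<subseteq> U i"
      and le: "\<And>i. open_content (U i) \<le> outer_content (A i) + ennreal (e * (1/2)^Suc i)"
      by metis
    have "outer_content (\<Union>i. A i) \<le> open_content (\<Union>i. U i)"
      using U by (intro outer_content_le) auto
    also have "\<dots> \<le> (\<Sum>i. open_content (U i))" by (rule open_content_UN[OF U(1)])
    also have "\<dots> \<le> (\<Sum>i. outer_content (A i) + ennreal (e * (1/2)^Suc i))"
      by (intro suminf_le le) auto
    also have "\<dots> = (\<Sum>i. outer_content (A i)) + (\<Sum>i. ennreal (e * (1/2)^Suc i))"
      by (intro suminf_add[symmetric]) auto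
    also have "(\<Sum>i. ennreal (e * (1/2)^Suc i)) = ennreal e"
      using e sums_mult[OF power_half_series, of e] by (intro suminf_ennreal_eq) auto
    finally show "outer_content (\<Union>i. A i) \<le> (\<Sum>i. outer_content (A i)) + ennreal e" .
  qed
qed

text \<open>This is the nontrivial half of Caratheodory's condition, for open test sets. Test
  functions for the two pieces are added after \<open>f\<close> has been lowered by a small
  \<open>d\<close>, so that the sum is still a test function for \<open>V\<close>.\<close>

lemma open_content_split:
  assumes U: "open U" and V: "open V"
  shows "open_content (U \<inter> V) + outer_content (V - U) \<le> open_content V"
proof -
  have ne: "below S \<noteq> {}" for S using below_zero by blast
  have "ennreal (L f) + outer_content (V - U) \<le> open_content V" if f: "f \<in> below (U \<inter> V)" for f
  proof (rule ennreal_le_epsilon)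
    fix d :: real assume d: "0 < d"
    \<comment> \<open>\<open>V - U\<close> need not be open, so it is enlarged to an open set that
      may meet \<open>U\<close>, but only where \<open>f\<close> is small.\<close>
    define W where "W = V \<inter> {x. f x < d}"
    have "open W"
      unfolding W_def using V belowD(1)[OF f]
      by (intro open_Int open_Collect_less continuous_intros Cb_continuous)
    moreover have "V - U \<subseteq> W"
      using belowD(4)[OF f] d by (auto simp: W_def)
    ultimately have VW: "outer_content (V - U) \<le> open_content W" by (rule outer_content_le)
    have "ennreal (L f) + ennreal (L g) \<le> open_content V + ennreal d" if g: "g \<in> below W" for g
    proof -
      \<comment> \<open>\<open>k\<close> vanishes on \<open>W\<close> and \<open>g\<close> vanishes
        off \<open>W\<close>, so at each point at most one summand of \<open>k + g\<close> is
        nonzero.\<close>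
      define k where "k x = max 0 (f x - d)" for x
      have k: "k \<in> Cb" unfolding k_def by (intro Cb_intros belowD(1)[OF f])
      have kg: "(\<lambda>x. k x + g x) \<in> below V"
      proof (rule belowI)
        show "(\<lambda>x. k x + g x) \<in> Cb" by (intro Cb_add k belowD(1)[OF g])
        show "0 \<le> k x + g x" for x using belowD(2)[OF g, of x] by (simp add: k_def)
        show "k x + g x \<le> 1" for x
        proof (cases "x \<in> W")
          case True
          then show ?thesis using belowD(3)[OF g, of x] by (simp add: k_def W_def)
        next
          case False
          then show ?thesis using belowD(3)[OF f, of x] belowD(4)[OF g, of x] d by (simp add: k_def)
        qed
        show "k x + g x = 0" if "x \<notin> V" for x
          using that belowD(4)[OF f, of x] belowD(4)[OF g, of x] d by (auto simp: k_def W_def)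
      qed
      have "L f - d \<le> L k"
        using mono[of "\<lambda>x. f x - d" k] k belowD(1)[OF f]
        by (auto simp: diff const Cb_intros k_def)
      then have "L f + L g \<le> L (\<lambda>x. k x + g x) + d"
        using add[OF k belowD(1)[OF g]] by simp
      then have "ennreal (L f) + ennreal (L g) \<le> ennreal (L (\<lambda>x. k x + g x)) + ennreal d"
        using d nonneg[OF belowD(1)[OF f] belowD(2)[OF f]] nonneg[OF belowD(1)[OF g] belowD(2)[OF g]]
          nonneg[OF belowD(1)[OF kg] belowD(2)[OF kg]]
        by (auto simp flip: ennreal_plus intro!: ennreal_leI)
      also have "\<dots> \<le> open_content V + ennreal d"
        by (intro add_right_mono open_content_upper kg)
      finally show ?thesis .
    qed
    then have "ennreal (L f) + open_content W \<le> open_content V + ennreal d"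
      unfolding open_content_def[of W] ennreal_SUP_add_right[OF ne] by (rule SUP_least)
    then show "ennreal (L f) + outer_content (V - U) \<le> open_content V + ennreal d"
      using VW by (meson add_left_mono order_trans)
  qed
  then show ?thesis
    unfolding open_content_def[of "U \<inter> V"] ennreal_SUP_add_left[OF ne, symmetric] by (rule SUP_least)
qed

text \<open>For open \<open>U\<close> the splitting inequality passes from open \<open>V\<close> to
  an arbitrary \<open>A\<close> by taking the infimum over open \<open>V\<close> containing
  \<open>A\<close>. The measurable sets form a sigma-algebra, so they contain the Borel
  sets.\<close>

lemma borel_subset_lambda_system: "sets borel \<subseteq> lambda_system UNIV (Pow UNIV) outer_content"
proof -
  let ?ls = "lambda_system UNIV (Pow UNIV) outer_content"
  note oms = outer_measure_space_outer_content
  have "open U \<Longrightarrow> U \<in> ?ls" for U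
  proof -
    assume U: "open U"
    have "outer_content (U \<inter> A) + outer_content ((UNIV - U) \<inter> A) = outer_content A" for A
    proof (rule antisym)
      have "outer_content (U \<inter> A) + outer_content ((UNIV - U) \<inter> A) \<le> open_content V"
        if V: "open V" "A \<subseteq> V" for V
      proof -
        have "outer_content (U \<inter> A) \<le> open_content (U \<inter> V)"
          using U V by (intro outer_content_le) auto
        moreover have "outer_content ((UNIV - U) \<inter> A) \<le> outer_content (V - U)"
          using V by (intro outer_content_mono) auto
        ultimately show ?thesis
          using open_content_split[OF U V(1)] by (meson add_mono order_trans)
      qed
      then show "outer_content (U \<inter> A) + outer_content ((UNIV - U) \<inter> A) \<le> outer_content A"
        unfolding outer_content_def[of A] by (intro INF_greatest) auto
      have "subadditive (Pow UNIV) outer_content"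
        using oms ring_of_sets.countably_subadditive_subadditive[OF ring_of_sets_Pow, of UNIV outer_content]
        by (simp add: outer_measure_space_def)
      then have "outer_content ((U \<inter> A) \<union> ((UNIV - U) \<inter> A)) \<le> outer_content (U \<inter> A) + outer_content ((UNIV - U) \<inter> A)"
        by (rule subadditiveD) auto
      moreover have "(U \<inter> A) \<union> ((UNIV - U) \<inter> A) = A" by blast
      ultimately show "outer_content A \<le> outer_content (U \<inter> A) + outer_content ((UNIV - U) \<inter> A)"
        by simp
    qed
    then show ?thesis by (simp add: lambda_system_def)
  qed
  moreover have "sigma_algebra UNIV ?ls"
    using sigma_algebra.caratheodory_lemma[OF sigma_algebra_Pow oms]
    by (simp add: measure_space_def)
  ultimately have "sigma_sets UNIV {S. open S} \<subseteq> ?ls"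
    by (intro sigma_algebra.sigma_sets_subset) auto
  then show ?thesis by (simp add: borel_def)
qed

section \<open>The representing measure and its inner regularity\<close>

definition rep_measure :: "'z measure" where
  "rep_measure = measure_of UNIV (sets borel) outer_content"

lemma sets_rep_measure: "sets rep_measure = sets borel"
  unfolding rep_measure_def by (metis sets.sets_measure_of_eq space_borel)

lemma emeasure_rep_measure:
  assumes "B \<in> sets borel" shows "emeasure rep_measure B = outer_content B"
proof (rule emeasure_measure_of[OF rep_measure_def])
  have "measure_space UNIV (sets borel) outer_content"
    using measure_down[OF sigma_algebra.caratheodory_lemma[OF sigma_algebra_Pow outer_measure_space_outer_content]
        _ borel_subset_lambda_system] sets.sigma_algebra_axioms[of borel]
    by simp
  then show "positive (sets rep_measure) outer_content" "countably_additive (sets rep_measure) outer_content"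
    by (auto simp: measure_space_def sets_rep_measure)
qed (use assms in \<open>auto simp: sets_rep_measure\<close>)

lemma emeasure_rep_measure_open: "open U \<Longrightarrow> emeasure rep_measure U = open_content U"
  by (simp add: emeasure_rep_measure outer_content_open)

lemma prob_space_rep_measure: "prob_space rep_measure"
proof
  have "space rep_measure = UNIV"
    using sets_eq_imp_space_eq[OF sets_rep_measure] by simp
  then show "emeasure rep_measure (space rep_measure) = 1"
    by (simp add: emeasure_rep_measure_open open_content_UNIV)
qed

text \<open>Outer regularity, applied to the complement of \<open>B\<close>, gives an open
  \<open>U\<close> whose overlap with \<open>B\<close> is small, and tightness gives a compact
  \<open>K\<close> with small complement. Then \<open>- U \<inter> K\<close> is a compact subset of
  \<open>B\<close> that misses at most \<open>e\<close> of its mass.\<close>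

lemma radon_prob_rep_measure: "radon_prob rep_measure"
  unfolding radon_prob_def
proof (intro conjI prob_space_rep_measure sets_rep_measure ballI antisym)
  interpret prob_space rep_measure by (rule prob_space_rep_measure)
  fix B assume B: "B \<in> sets rep_measure"
  then have B': "B \<in> sets borel" by (simp add: sets_rep_measure)
  let ?S = "SUP K\<in>{K. compact K \<and> K \<subseteq> B}. emeasure rep_measure K"
  show "?S \<le> emeasure rep_measure B"
    by (intro SUP_least emeasure_mono) (use B in auto)
  show "emeasure rep_measure B \<le> ?S"
  proof (rule ennreal_le_epsilon)
    fix e :: real assume e: "0 < e"
    obtain U where U: "open U" "- B \<subseteq> U" "open_content U \<le> outer_content (- B) + ennreal (e/2)"
      using outer_content_approx half_gt_zero[OF e] by metis
    obtain K where K: "compact K"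
      and KL: "\<And>h. h \<in> Cb \<Longrightarrow> \<forall>x\<in>K. h x \<le> 0 \<Longrightarrow> \<forall>x. h x \<le> 1 \<Longrightarrow> L h \<le> e/2"
      using tightE[of "e/2"] e by (metis half_gt_zero)
    have meas: "U \<in> sets rep_measure" "- K \<in> sets rep_measure" "- B \<in> sets rep_measure"
      "- U \<inter> K \<in> sets rep_measure"
      using U(1) compact_closed[OF K] B' by (auto simp: sets_rep_measure)
    have "L f \<le> e/2" if "f \<in> below (- K)" for f
    proof (rule KL)
      show "\<forall>x\<in>K. f x \<le> 0" using belowD(4)[OF that] by simp
      show "\<forall>x. f x \<le> 1" using belowD(3)[OF that] by simp
    qed (rule belowD(1)[OF that])
    then have K2: "emeasure rep_measure (- K) \<le> ennreal (e/2)"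
      using compact_closed[OF K]
      by (subst emeasure_rep_measure_open) (auto simp: open_content_def intro!: SUP_least ennreal_leI)
    have "emeasure rep_measure (- B) + emeasure rep_measure (U \<inter> B) = emeasure rep_measure U"
      using U(2) meas B by (subst plus_emeasure) (auto intro!: arg_cong[of _ _ "emeasure rep_measure"])
    also have "\<dots> \<le> emeasure rep_measure (- B) + ennreal (e/2)"
      using U B' by (simp add: emeasure_rep_measure_open emeasure_rep_measure)
    finally have U2: "emeasure rep_measure (U \<inter> B) \<le> ennreal (e/2)"
      by (simp add: ennreal_add_left_cancel_le)
    have "emeasure rep_measure B \<le> emeasure rep_measure ((- U \<inter> K) \<union> ((U \<inter> B) \<union> - K))"
      using U(2) meas B by (intro emeasure_mono) auto
    also have "\<dots> \<le> emeasure rep_measure (- U \<inter> K) + (emeasure rep_measure (U \<inter> B) + emeasure rep_measure (- K))"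
      using meas B by (intro order_trans[OF emeasure_subadditive] add_left_mono emeasure_subadditive) auto
    also have "\<dots> \<le> ?S + (ennreal (e/2) + ennreal (e/2))"
    proof (intro add_mono U2 K2 SUP_upper)
      show "- U \<inter> K \<in> {K. compact K \<and> K \<subseteq> B}"
        using U K compact_Int_closed[OF K, of "- U"] by (auto simp: Int_commute)
    qed
    also have "ennreal (e/2) + ennreal (e/2) = ennreal e"
      using e by (simp flip: ennreal_plus)
    finally show "emeasure rep_measure B \<le> ?S + ennreal e" .
  qed
qed

section \<open>Domination of integrals by the functional\<close>

lemma open_content_le:
  assumes "h \<in> Cb" "0 < d" "\<And>x. 0 \<le> h x" "\<And>x. x \<in> U \<Longrightarrow> d \<le> h x"
  shows "ennreal d * open_content U \<le> ennreal (L h)"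
proof -
  \<comment> \<open>Markov's inequality, proved for each \<open>f\<close> in \<open>below U\<close>
    through \<open>d * f \<le> h\<close>.\<close>
  have "open_content U \<le> ennreal (L h / d)"
    unfolding open_content_def
  proof (intro SUP_least ennreal_leI)
    fix f assume f: "f \<in> below U"
    have "d * f x \<le> h x" for x
    proof (cases "x \<in> U")
      case True
      have "d * f x \<le> d * 1" using belowD(3)[OF f] assms(2) by (intro mult_left_mono) auto
      also have "\<dots> \<le> h x" using assms(4)[OF True] by simp
      finally show ?thesis .
    qed (use belowD(4)[OF f] assms(3) in simp)
    then have "d * L f \<le> L h"
      using mono[OF Cb_cmult assms(1), of f d] belowD(1)[OF f] cmult by simp
    then show "L f \<le> L h / d" using assms(2) by (simp add: field_simps)
  qed
  then have "ennreal d * open_content U \<le> ennreal d * ennreal (L h / d)"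
    by (rule mult_left_mono) simp
  also have "\<dots> = ennreal (L h)"
    using assms(2) nonneg[OF assms(1,3)] by (simp flip: ennreal_mult)
  finally show ?thesis .
qed

text \<open>A discrete layer-cake estimate: the slice of \<open>f\<close> between the levels \<open>(N+1)d\<close> and \<open>(N+2)d\<close> is
  at most \<open>d\<close> times the indicator of \<open>f > (N+1)d\<close>, which is below the previous slice. This shift by
  one level costs the summand \<open>d\<close>.\<close>

lemma nn_integral_truncation_le:
  assumes f: "f \<in> Cb" "\<And>x. 0 \<le> f x" and d: "0 < d"
  shows "(\<integral>\<^sup>+x. ennreal (min (f x) (real (Suc N) * d)) \<partial>rep_measure)
    \<le> ennreal (d + L (\<lambda>x. min (f x) (real N * d)))"
proof (induction N)
  case 0
  interpret prob_space rep_measure by (rule prob_space_rep_measure)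
  have "(\<integral>\<^sup>+x. ennreal (min (f x) (real (Suc 0) * d)) \<partial>rep_measure) \<le> (\<integral>\<^sup>+x. ennreal d \<partial>rep_measure)"
    by (intro nn_integral_mono ennreal_leI) simp
  also have "\<dots> = ennreal d" by (simp add: emeasure_space_1)
  finally show ?case using f by (simp add: min_absorb2 const)
next
  case (Suc N)
  let ?U = "{x. real (Suc N) * d < f x}"
  have U: "open ?U"
    using f by (intro open_Collect_less continuous_intros Cb_continuous)
  have meas: "(\<lambda>x. min (f x) (real (Suc N) * d)) \<in> borel_measurable rep_measure"
    by (intro Cb_borel_measurable sets_rep_measure Cb_intros f)
  have Cbs: "(\<lambda>x. min (f x) (a * d)) \<in> Cb" for a
    by (intro Cb_intros f)
  have N0: "0 \<le> L (\<lambda>x. min (f x) (real N * d))"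
    using f d by (intro nonneg Cbs) simp
  have "min (f x) (real (Suc (Suc N)) * d) \<le> min (f x) (real (Suc N) * d) + d * indicator ?U x" for x
    by (auto simp: indicator_def min_def algebra_simps)
  then have "(\<integral>\<^sup>+x. ennreal (min (f x) (real (Suc (Suc N)) * d)) \<partial>rep_measure)
      \<le> (\<integral>\<^sup>+x. ennreal (min (f x) (real (Suc N) * d)) + ennreal d * indicator ?U x \<partial>rep_measure)"
    using f d by (intro nn_integral_mono)
      (auto simp flip: ennreal_plus simp: ennreal_indicator[symmetric] ennreal_mult[symmetric] simp del: of_nat_Suc intro!: ennreal_leI)
  also have "\<dots> = (\<integral>\<^sup>+x. ennreal (min (f x) (real (Suc N) * d)) \<partial>rep_measure) + ennreal d * open_content ?U"
  proof -
    have "?U \<in> sets rep_measure" using U by (simp add: sets_rep_measure)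
    with meas show ?thesis
      by (simp add: nn_integral_add nn_integral_cmult_indicator emeasure_rep_measure_open[OF U] del: of_nat_Suc)
  qed
  also have "\<dots> \<le> ennreal (d + L (\<lambda>x. min (f x) (real N * d)))
      + ennreal (L (\<lambda>x. min (f x) (real (Suc N) * d) - min (f x) (real N * d)))"
  proof (intro add_mono Suc.IH open_content_le d)
    show "(\<lambda>x. min (f x) (real (Suc N) * d) - min (f x) (real N * d)) \<in> Cb"
      by (intro Cb_diff Cbs)
  qed (use d in \<open>auto simp: min_def algebra_simps\<close>)
  also have "\<dots> = ennreal (d + L (\<lambda>x. min (f x) (real (Suc N) * d)))"
  proof -
    have "L (\<lambda>x. min (f x) (real N * d)) \<le> L (\<lambda>x. min (f x) (real (Suc N) * d))"
      using d by (intro mono Cbs) (auto simp: min_def algebra_simps)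
    then show ?thesis
      using N0 d by (subst diff[OF Cbs Cbs]) (simp flip: ennreal_plus)
  qed
  finally show ?case .
qed

text \<open>Since \<open>f\<close> is bounded, both truncations equal \<open>f\<close> once
  \<open>N\<close> is large, and the error \<open>d\<close> is arbitrary.\<close>

lemma nn_integral_rep_measure_le:
  assumes f: "f \<in> Cb" "\<And>x. 0 \<le> f x"
  shows "(\<integral>\<^sup>+x. ennreal (f x) \<partial>rep_measure) \<le> ennreal (L f)"
proof (rule ennreal_le_epsilon)
  fix d :: real assume d: "0 < d"
  from f(1) obtain B where B: "\<And>x. \<bar>f x\<bar> \<le> B" by (metis CbE)
  obtain N where "B < real N * d" using reals_Archimedean3[OF d] by blast
  then have N: "f x \<le> real N * d" "f x \<le> real (Suc N) * d" for x
    using B[of x] d by (auto simp: algebra_simps)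
  have "(\<integral>\<^sup>+x. ennreal (f x) \<partial>rep_measure) \<le> ennreal (d + L f)"
    using nn_integral_truncation_le[OF f d, of N] N by (simp add: min_absorb1 del: of_nat_Suc)
  then show "(\<integral>\<^sup>+x. ennreal (f x) \<partial>rep_measure) \<le> ennreal (L f) + ennreal d"
    using d nonneg[OF f] by (simp add: add.commute)
qed

end

subsection \<open>Topological and measure-theoretic preliminaries\<close>

lemma Urysohn_Cb:
  assumes "normal_space (euclidean :: 'a::topological_space topology)"
    and "closed (S :: 'a set)" "closed T" "S \<inter> T = {}"
  obtains f where "f \<in> Cb" "\<forall>x. 0 \<le> f x" "\<forall>x. f x \<le> 1" "\<forall>x\<in>S. f x = 0" "\<forall>x\<in>T. f x = (1::real)"
proof -
  obtain f where f: "continuous_map euclidean (top_of_set {0..1::real}) f" "f ` S \<subseteq> {0}" "f ` T \<subseteq> {1}"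
    by (rule Urysohn_lemma[of "euclidean :: 'a topology" S T 0 1])
      (use assms in \<open>auto simp: disjnt_def\<close>)
  then have "continuous_on UNIV f" and bds: "\<And>x. 0 \<le> f x \<and> f x \<le> 1"
    by (auto simp: continuous_map_in_subtopology)
  then have "f \<in> Cb" by (intro CbI[of _ 1]) (auto simp: abs_le_iff intro: order_trans[of _ 0])
  with f bds show ?thesis by (intro that[of f]) auto
qed

lemma completely_regular_separation:
  assumes "completely_regular_space (euclidean :: 'a::topological_space topology)"
    and "open U" "(z::'a) \<in> U"
  shows "\<exists>f\<in>Cb. f z = 1 \<and> (\<forall>x. 0 \<le> f x \<and> f x \<le> (indicator U x :: real))"
proof -
  have "closedin euclidean (- U)" "z \<in> topspace euclidean - - U"
    using assms by auto
  then obtain f where f: "continuous_map euclidean (top_of_set {0..1::real}) f" "f z = 0" "f ` (- U) \<subseteq> {1}"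
    using assms(1) unfolding completely_regular_space_def by metis
  then have cont: "continuous_on UNIV f" and bds: "\<And>x. 0 \<le> f x \<and> f x \<le> 1"
    by (auto simp: continuous_map_in_subtopology)
  have "(\<lambda>x. 1 - f x) \<in> Cb"
    using cont bds by (intro CbI[of _ 1] continuous_intros) auto
  moreover have "1 - f x \<le> indicator U x" for x
    using f(3) bds[of x] by (cases "x \<in> U") auto
  ultimately show ?thesis
    using f(2) bds by (intro bexI[of _ "\<lambda>x. 1 - f x"]) auto
qed

lemma Hausdorff_compact_closed:
  assumes "Hausdorff_space (euclidean :: 'a::topological_space topology)" "compact (K::'a set)"
  shows "closed K"
  using compactin_imp_closedin[OF assms(1), of K] assms(2) by simp

text \<open>The path from \<open>(x, y)\<close> to \<open>(x0, y0)\<close> goes through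
  \<open>(x0, y)\<close>. The first leg is controlled uniformly in \<open>y\<close>, so the
  neighbourhood of \<open>x0\<close> can be chosen independently of \<open>y\<close>.\<close>

lemma property_H_continuous:
  fixes f :: "'a::topological_space \<times> 'b::topological_space \<Rightarrow> real"
  assumes "property_H f"
  shows "continuous_on UNIV f"
proof -
  have "(f \<longlongrightarrow> f (x0, y0)) (nhds (x0, y0))" for x0 y0
  proof (rule tendstoI)
    fix e :: real assume e: "0 < e"
    have "\<forall>\<^sub>F x in at x0. dbar f x x0 < ereal (e/2)" "\<forall>\<^sub>F y in at y0. dund f y y0 < ereal (e/2)"
      using assms e by (auto simp: property_H_def intro!: order_tendstoD(2)[of _ 0])
    \<comment> \<open>The limits in property (H) concern punctured neighbourhoods; the centre is
      added by hand.\<close>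
    moreover have "dbar f x0 x0 < ereal (e/2)" "dund f y0 y0 < ereal (e/2)"
      using e by (auto simp: dbar_def dund_def)
    ultimately have ev: "\<forall>\<^sub>F x in nhds x0. dbar f x x0 < ereal (e/2)"
      "\<forall>\<^sub>F y in nhds y0. dund f y y0 < ereal (e/2)"
      by (auto simp: eventually_nhds_conv_at)
    have "dist (f (x, y)) (f (x0, y0)) < e"
      if "dbar f x x0 < ereal (e/2)" "dund f y y0 < ereal (e/2)" for x y
    proof -
      have "ereal \<bar>f (x, y) - f (x0, y)\<bar> \<le> dbar f x x0"
        unfolding dbar_def by (rule SUP_upper) simp
      moreover have "ereal \<bar>f (x0, y) - f (x0, y0)\<bar> \<le> dund f y y0"
        unfolding dund_def by (rule SUP_upper) simp
      ultimately have "\<bar>f (x, y) - f (x0, y)\<bar> < e/2" "\<bar>f (x0, y) - f (x0, y0)\<bar> < e/2"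
        using that by (auto dest: le_less_trans)
      then show ?thesis unfolding dist_real_def by linarith
    qed
    with ev show "\<forall>\<^sub>F z in nhds (x0, y0). dist (f z) (f (x0, y0)) < e"
      unfolding nhds_prod eventually_prod_filter by blast
  qed
  then show ?thesis
    by (auto simp: continuous_on_def tendsto_at_iff_tendsto_nhds)
qed

lemma radon_prob_tight:
  fixes M :: "'a::topological_space measure"
  assumes M: "radon_prob M" and haus: "Hausdorff_space (euclidean :: 'a topology)" and e: "0 < (e::real)"
  obtains K where "compact K" "closed K" "measure M (- K) \<le> e"
proof -
  interpret prob_space M using M by (simp add: radon_prob_def)
  have sets: "sets M = sets borel" using M by (simp add: radon_prob_def)
  have sp: "space M = UNIV" using sets_eq_imp_space_eq[OF sets] by simp
  have "ennreal (1 - e) < emeasure M UNIV"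
    using e emeasure_space_1 by (simp add: sp)
  also have "emeasure M UNIV = (SUP K\<in>{K. compact K \<and> K \<subseteq> UNIV}. emeasure M K)"
    using M sets by (simp add: radon_prob_def)
  finally obtain K where K: "compact K" "ennreal (1 - e) < emeasure M K"
    by (auto simp: less_SUP_iff)
  have "closed K" by (rule Hausdorff_compact_closed[OF haus K(1)])
  moreover have "1 - e < measure M K"
    using K(2) unfolding emeasure_eq_measure by (metis ennreal_leI not_le)
  ultimately show ?thesis
    using prob_compl[of K] K(1) by (intro that[of K]) (auto simp: sp sets Compl_eq_Diff_UNIV)
qed

text \<open>The lower bound on open sets gives an upper bound on the (closed) compact sets, which inner
  regularity of \<open>\<gamma>\<close> carries to all Borel sets; complements turn the inequality into equality.\<close>

lemma radon_distr_eqI: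
  fixes \<gamma> :: "'z::topological_space measure" and \<mu> :: "'a::topological_space measure"
  assumes \<gamma>: "radon_prob \<gamma>" and \<mu>: "radon_prob \<mu>"
    and haus: "Hausdorff_space (euclidean :: 'a topology)"
    and cont: "continuous_on UNIV \<pi>"
    and lower: "\<And>U K. open U \<Longrightarrow> compact K \<Longrightarrow> K \<subseteq> U \<Longrightarrow> emeasure \<mu> K \<le> emeasure \<gamma> (\<pi> -` U)"
  shows "distr \<gamma> borel \<pi> = \<mu>"
proof -
  interpret G: prob_space \<gamma> using \<gamma> by (simp add: radon_prob_def)
  interpret M: prob_space \<mu> using \<mu> by (simp add: radon_prob_def)
  have sets: "sets \<gamma> = sets borel" "sets \<mu> = sets borel"
    using \<gamma> \<mu> by (auto simp: radon_prob_def)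
  have sp: "space \<gamma> = UNIV" "space \<mu> = UNIV"
    using sets_eq_imp_space_eq[OF sets(1)] sets_eq_imp_space_eq[OF sets(2)] by auto
  have \<pi>: "\<pi> \<in> measurable \<gamma> borel"
    using borel_measurable_continuous_onI[OF cont] sets(1) by (metis measurable_cong_sets)
  have vim: "\<pi> -` B \<in> sets \<gamma>" if "B \<in> sets borel" for B
    using measurable_sets[OF \<pi> that] by (simp add: sp)
  have compl: "measure \<gamma> (\<pi> -` (- B)) = 1 - measure \<gamma> (\<pi> -` B)" "measure \<mu> (- B) = 1 - measure \<mu> B"
    if "B \<in> sets borel" for B
    using G.prob_compl[OF vim[OF that]] M.prob_compl[of B] that
    by (auto simp: sp sets vimage_Compl Compl_eq_Diff_UNIV[symmetric])
  have inner_\<gamma>: "emeasure \<gamma> B = (SUP K\<in>{K. compact K \<and> K \<subseteq> B}. emeasure \<gamma> K)" if "B \<in> sets borel" for B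
    using \<gamma> that unfolding radon_prob_def by blast
  have inner_\<mu>: "emeasure \<mu> B = (SUP K\<in>{K. compact K \<and> K \<subseteq> B}. emeasure \<mu> K)" if "B \<in> sets borel" for B
    using \<mu> that unfolding radon_prob_def by blast
  have opens: "measure \<mu> U \<le> measure \<gamma> (\<pi> -` U)" if "open U" for U
  proof -
    have "emeasure \<mu> U \<le> emeasure \<gamma> (\<pi> -` U)"
      using that by (subst inner_\<mu>) (auto intro!: SUP_least lower)
    then show ?thesis by (simp add: G.emeasure_eq_measure M.emeasure_eq_measure)
  qed
  have le: "measure \<gamma> (\<pi> -` B) \<le> measure \<mu> B" if B: "B \<in> sets borel" for B
  proof -
    have "emeasure \<gamma> K \<le> emeasure \<mu> B" if K: "compact K" "K \<subseteq> \<pi> -` B" for K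
    proof -
      have "compact (\<pi> ` K)"
        using K(1) continuous_on_subset[OF cont] by (intro compact_continuous_image) auto
      then have C: "closed (\<pi> ` K)" by (rule Hausdorff_compact_closed[OF haus])
      have "measure \<gamma> (\<pi> -` (\<pi> ` K)) = 1 - measure \<gamma> (\<pi> -` (- \<pi> ` K))"
        using C by (simp add: compl)
      also have "\<dots> \<le> 1 - measure \<mu> (- \<pi> ` K)"
        using opens C by auto
      also have "\<dots> = measure \<mu> (\<pi> ` K)"
        using C by (simp add: compl)
      finally have "measure \<gamma> (\<pi> -` (\<pi> ` K)) \<le> measure \<mu> (\<pi> ` K)" .
      moreover have "measure \<gamma> K \<le> measure \<gamma> (\<pi> -` (\<pi> ` K))"
        using vim C by (intro G.finite_measure_mono) auto
      moreover have "measure \<mu> (\<pi> ` K) \<le> measure \<mu> B"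
        using B K by (intro M.finite_measure_mono) (auto simp: sets)
      ultimately show ?thesis by (simp add: G.emeasure_eq_measure M.emeasure_eq_measure)
    qed
    then have "emeasure \<gamma> (\<pi> -` B) \<le> emeasure \<mu> B"
      using vim[OF B] by (subst inner_\<gamma>) (auto simp: sets intro!: SUP_least)
    then show ?thesis by (simp add: G.emeasure_eq_measure M.emeasure_eq_measure)
  qed
  show ?thesis
  proof (rule measure_eqI)
    fix B assume "B \<in> sets (distr \<gamma> borel \<pi>)"
    then have B: "B \<in> sets borel" by simp
    have "measure \<gamma> (\<pi> -` (- B)) \<le> measure \<mu> (- B)" using B by (intro le) auto
    then have "measure \<mu> B \<le> measure \<gamma> (\<pi> -` B)"
      using compl[OF B] by simp
    with le[OF B] show "emeasure (distr \<gamma> borel \<pi>) B = emeasure \<mu> B"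
      using B by (simp add: emeasure_distr[OF \<pi>] sp G.emeasure_eq_measure M.emeasure_eq_measure)
  qed (simp add: sets)
qed

subsection \<open>Strong duality\<close>

text \<open>The third property is \<open>L \<le> p\<close> with the infimum unfolded. Every later
  fact about \<open>L\<close> beyond linearity comes from choosing potentials, \<open>t\<close> and
  \<open>n\<close> in it.\<close>

lemma transport_functional:
  fixes \<mu> :: "'a::topological_space measure" and \<nu> :: "'b::topological_space measure"
    and cn :: "nat \<Rightarrow> 'a \<times> 'b \<Rightarrow> real" and V :: real
  assumes prob: "prob_space \<mu>" "prob_space \<nu>" and sets: "sets \<mu> = sets borel" "sets \<nu> = sets borel"
    and inc: "\<And>m n z. m \<le> n \<Longrightarrow> cn m z \<le> cn n z"
    and dual: "\<And>\<phi> \<psi> n. \<phi> \<in> Cb \<Longrightarrow> \<psi> \<in> Cb \<Longrightarrow> (\<And>x y. \<phi> x + \<psi> y \<le> cn n (x, y)) \<Longrightarrow>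
      integral\<^sup>L \<mu> \<phi> + integral\<^sup>L \<nu> \<psi> \<le> V"
  shows "\<exists>L :: ('a \<times> 'b \<Rightarrow> real) \<Rightarrow> real.
      (\<forall>f\<in>Cb. \<forall>g\<in>Cb. L (\<lambda>x. f x + g x) = L f + L g) \<and>
      (\<forall>f\<in>Cb. \<forall>a. L (\<lambda>x. a * f x) = a * L f) \<and>
      (\<forall>h\<in>Cb. \<forall>\<phi>\<in>Cb. \<forall>\<psi>\<in>Cb. \<forall>t\<ge>0. \<forall>n.
        (\<forall>x y. h (x, y) \<le> \<phi> x + \<psi> y + t * cn n (x, y)) \<longrightarrow>
        L h \<le> integral\<^sup>L \<mu> \<phi> + integral\<^sup>L \<nu> \<psi> + t * V)"
proof -
  interpret M: prob_space \<mu> by fact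
  interpret N: prob_space \<nu> by fact
  have int\<mu>: "integrable \<mu> \<phi>" if "\<phi> \<in> Cb" for \<phi>
    by (rule Cb_integrable[OF that M.finite_measure_axioms sets(1)])
  have int\<nu>: "integrable \<nu> \<psi>" if "\<psi> \<in> Cb" for \<psi>
    by (rule Cb_integrable[OF that N.finite_measure_axioms sets(2)])
  define S where "S h = {integral\<^sup>L \<mu> \<phi> + integral\<^sup>L \<nu> \<psi> + t * V | \<phi> \<psi> t n.
      \<phi> \<in> Cb \<and> \<psi> \<in> Cb \<and> 0 \<le> t \<and> (\<forall>x y. h (x, y) \<le> \<phi> x + \<psi> y + t * cn n (x, y))}"
    for h :: "'a \<times> 'b \<Rightarrow> real"
  have SI: "integral\<^sup>L \<mu> \<phi> + integral\<^sup>L \<nu> \<psi> + t * V \<in> S h"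
    if "\<phi> \<in> Cb" "\<psi> \<in> Cb" "0 \<le> t" "\<And>x y. h (x, y) \<le> \<phi> x + \<psi> y + t * cn n (x, y)" for h \<phi> \<psi> t n
    unfolding S_def using that by blast
  \<comment> \<open>This makes \<open>p\<close> finite, and with \<open>B = 0\<close> it gives
    \<open>0 \<le> p 0\<close>. For \<open>t = 0\<close> the pointwise inequality is integrated in
    one variable at a time.\<close>
  have key: "- B \<le> a" if "a \<in> S h" "\<And>z. - B \<le> h z" for a h B
  proof -
    from that obtain \<phi> \<psi> t n where a: "a = integral\<^sup>L \<mu> \<phi> + integral\<^sup>L \<nu> \<psi> + t * V"
      and \<phi>: "\<phi> \<in> Cb" and \<psi>: "\<psi> \<in> Cb" and t: "0 \<le> t"
      and le: "\<And>x y. - B \<le> \<phi> x + \<psi> y + t * cn n (x, y)"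
      unfolding S_def by (smt (verit) mem_Collect_eq)
    show ?thesis
    proof (cases "t = 0")
      case True
      have "- B - \<psi> y \<le> integral\<^sup>L \<mu> \<phi>" for y
        using le[of _ y] True by (intro M.integral_ge_const int\<mu> \<phi>) (auto simp: algebra_simps)
      then have "- B - integral\<^sup>L \<mu> \<phi> \<le> integral\<^sup>L \<nu> \<psi>"
        by (intro N.integral_ge_const int\<nu> \<psi>) (auto simp: algebra_simps)
      then show ?thesis by (simp add: a True)
    next
      case False
      with t have t: "0 < t" by simp
      \<comment> \<open>Solving the pointwise inequality for \<open>cn n\<close> turns the negated
        potentials, divided by \<open>t\<close>, into admissible ones for the dual problem; the
        constant \<open>B\<close> is absorbed into the first.\<close>
      have "integral\<^sup>L \<mu> (\<lambda>x. (- 1 / t) * (\<phi> x + B)) + integral\<^sup>L \<nu> (\<lambda>y. (- 1 / t) * \<psi> y) \<le> V"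
      proof (rule dual)
        fix x y
        show "- 1 / t * (\<phi> x + B) + - 1 / t * \<psi> y \<le> cn n (x, y)"
          using le[of x y] t by (simp add: field_simps)
      qed (intro Cb_intros \<phi> \<psi>)+
      moreover have "integral\<^sup>L \<mu> (\<lambda>x. (- 1 / t) * (\<phi> x + B)) = (- 1 / t) * (integral\<^sup>L \<mu> \<phi> + B)"
        using int\<mu>[OF \<phi>] by (subst integral_mult_right_zero) (simp add: M.prob_space)
      moreover have "integral\<^sup>L \<nu> (\<lambda>y. (- 1 / t) * \<psi> y) = (- 1 / t) * integral\<^sup>L \<nu> \<psi>"
        by (rule integral_mult_right_zero)
      ultimately show ?thesis using t by (simp add: a field_simps)
    qed
  qed
  have bdd: "bdd_below (S h)" and ne: "S h \<noteq> {}" if "h \<in> Cb" for h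
  proof -
    from that obtain B where B: "\<And>z. \<bar>h z\<bar> \<le> B" by (metis CbE)
    then have "- B \<le> h z" "h z \<le> B" for z by (auto simp: abs_le_iff minus_le_iff)
    then show "bdd_below (S h)" "S h \<noteq> {}"
      using key[of _ h B] SI[OF Cb_const Cb_const, of 0 h B 0] by (auto intro!: bdd_belowI[of _ "- B"])
  qed
  \<comment> \<open>The two competitors may use different indices; monotonicity replaces both costs
    by the one with index \<open>max n n'\<close>.\<close>
  have S_add: "a + b \<in> S (\<lambda>z. h z + k z)" if ab: "a \<in> S h" "b \<in> S k" for a b h k
  proof -
    from ab(1) obtain \<phi> \<psi> t n where a: "a = integral\<^sup>L \<mu> \<phi> + integral\<^sup>L \<nu> \<psi> + t * V"
      and 1: "\<phi> \<in> Cb" "\<psi> \<in> Cb" "0 \<le> t" "\<And>x y. h (x, y) \<le> \<phi> x + \<psi> y + t * cn n (x, y)"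
      unfolding S_def by blast
    from ab(2) obtain \<phi>' \<psi>' t' n' where b: "b = integral\<^sup>L \<mu> \<phi>' + integral\<^sup>L \<nu> \<psi>' + t' * V"
      and 2: "\<phi>' \<in> Cb" "\<psi>' \<in> Cb" "0 \<le> t'" "\<And>x y. k (x, y) \<le> \<phi>' x + \<psi>' y + t' * cn n' (x, y)"
      unfolding S_def by blast
    have "integral\<^sup>L \<mu> (\<lambda>x. \<phi> x + \<phi>' x) + integral\<^sup>L \<nu> (\<lambda>y. \<psi> y + \<psi>' y) + (t + t') * V \<in> S (\<lambda>z. h z + k z)"
    proof (rule SI[of _ _ _ _ "max n n'"])
      fix x y
      have "t * cn n (x, y) \<le> t * cn (max n n') (x, y)" "t' * cn n' (x, y) \<le> t' * cn (max n n') (x, y)"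
        using 1(3) 2(3) by (auto intro!: mult_left_mono inc)
      then show "h (x, y) + k (x, y) \<le> \<phi> x + \<phi>' x + (\<psi> y + \<psi>' y) + (t + t') * cn (max n n') (x, y)"
        using 1(4)[of x y] 2(4)[of x y] by (simp add: algebra_simps)
    qed (use 1 2 in \<open>auto intro: Cb_add\<close>)
    then show ?thesis
      using int\<mu>[OF 1(1)] int\<mu>[OF 2(1)] int\<nu>[OF 1(2)] int\<nu>[OF 2(2)] by (simp add: a b algebra_simps)
  qed
  have S_scale: "r * a \<in> S (\<lambda>z. r * h z)" if a: "a \<in> S h" and r: "0 < r" for a h r
  proof -
    from a obtain \<phi> \<psi> t n where a: "a = integral\<^sup>L \<mu> \<phi> + integral\<^sup>L \<nu> \<psi> + t * V"
      and 1: "\<phi> \<in> Cb" "\<psi> \<in> Cb" "0 \<le> t" "\<And>x y. h (x, y) \<le> \<phi> x + \<psi> y + t * cn n (x, y)"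
      unfolding S_def by blast
    have "integral\<^sup>L \<mu> (\<lambda>x. r * \<phi> x) + integral\<^sup>L \<nu> (\<lambda>y. r * \<psi> y) + (r * t) * V \<in> S (\<lambda>z. r * h z)"
    proof (rule SI[of _ _ _ _ n])
      fix x y
      have "r * h (x, y) \<le> r * (\<phi> x + \<psi> y + t * cn n (x, y))"
        using r 1(4) by (intro mult_left_mono) auto
      then show "r * h (x, y) \<le> r * \<phi> x + r * \<psi> y + r * t * cn n (x, y)"
        by (simp add: algebra_simps)
    qed (use 1 r in \<open>auto intro: Cb_cmult\<close>)
    then show ?thesis by (simp add: a algebra_simps)
  qed
  \<comment> \<open>Hahn-Banach needs a real vector space as a type, so the argument moves to
    \<open>bcontfun\<close> here and returns through \<open>Bcontfun\<close>.\<close>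
  have Cb_apply: "apply_bcontfun h \<in> Cb" for h :: "('a \<times> 'b) \<Rightarrow>\<^sub>C real"
    by (simp add: Cb_def)
  define p where "p h = Inf (S (apply_bcontfun h))" for h :: "('a \<times> 'b) \<Rightarrow>\<^sub>C real"
  have lower: "p h \<le> a" if "a \<in> S (apply_bcontfun h)" for a h
    unfolding p_def by (rule cInf_lower[OF that bdd[OF Cb_apply]])
  have great: "a \<le> p h" if "\<And>b. b \<in> S (apply_bcontfun h) \<Longrightarrow> a \<le> b" for a h
    unfolding p_def by (rule cInf_greatest[OF ne[OF Cb_apply] that])
  have apply_simps: "apply_bcontfun (h + k) = (\<lambda>z. apply_bcontfun h z + apply_bcontfun k z)"
    "apply_bcontfun (r *\<^sub>R h) = (\<lambda>z. r * apply_bcontfun h z)"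
    "apply_bcontfun 0 = (\<lambda>z. 0)" for h k :: "('a \<times> 'b) \<Rightarrow>\<^sub>C real" and r
    by auto
  have "sublinear p"
  proof (rule sublinearI)
    fix h k
    have "p (h + k) \<le> a + b" if "a \<in> S (apply_bcontfun h)" "b \<in> S (apply_bcontfun k)" for a b
      using S_add[OF that] by (intro lower) (simp add: apply_simps)
    then have "p (h + k) - b \<le> p h" if "b \<in> S (apply_bcontfun k)" for b
      using that by (intro great) (simp add: diff_le_eq)
    then have "p (h + k) - p h \<le> p k"
      by (intro great) (simp add: algebra_simps)
    then show "p (h + k) \<le> p h + p k" by simp
  next
    fix r :: real and h assume r: "0 < r"
    have "p (r *\<^sub>R h) \<le> r * a" if "a \<in> S (apply_bcontfun h)" for a
      using S_scale[OF that r] by (intro lower) (simp add: apply_simps)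
    then have "p (r *\<^sub>R h) / r \<le> p h"
      using r by (intro great) (simp add: field_simps)
    then show "p (r *\<^sub>R h) \<le> r * p h" using r by (simp add: field_simps)
  next
    have "p 0 \<le> 0"
      using SI[OF Cb_const Cb_const, of 0 "\<lambda>_. 0" 0 0] by (intro lower) (simp add: apply_simps)
    moreover have "0 \<le> p 0"
      using key[of _ "\<lambda>_. 0" 0] by (intro great) (simp add: apply_simps)
    ultimately show "p 0 = 0" by simp
  qed
  then obtain l where l: "linear l" "l \<le> p" by (rule Hahn_Banach_sublinear)
  have Bcontfun_apply: "apply_bcontfun (Bcontfun h) = h" if "h \<in> Cb" for h :: "'a \<times> 'b \<Rightarrow> real"
    using that by (intro Bcontfun_inverse) (simp add: Cb_def bcontfun_def)
  show ?thesis
  proof (intro exI[of _ "\<lambda>h. l (Bcontfun h)"] conjI ballI allI impI)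
    fix f g :: "'a \<times> 'b \<Rightarrow> real" assume fg: "f \<in> Cb" "g \<in> Cb"
    have "Bcontfun (\<lambda>x. f x + g x) = Bcontfun f + Bcontfun g"
      by (rule bcontfun_eqI) (simp add: Bcontfun_apply fg Cb_add)
    then show "l (Bcontfun (\<lambda>x. f x + g x)) = l (Bcontfun f) + l (Bcontfun g)"
      by (simp add: linear_add[OF l(1)])
  next
    fix f :: "'a \<times> 'b \<Rightarrow> real" and a :: real assume f: "f \<in> Cb"
    have "Bcontfun (\<lambda>x. a * f x) = a *\<^sub>R Bcontfun f"
      by (rule bcontfun_eqI) (simp add: Bcontfun_apply f Cb_cmult)
    then show "l (Bcontfun (\<lambda>x. a * f x)) = a * l (Bcontfun f)"
      by (simp add: linear_scale[OF l(1)])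
  next
    fix h \<phi> \<psi> t n
    assume h: "h \<in> Cb" and "\<phi> \<in> Cb" "\<psi> \<in> Cb" "0 \<le> t"
      and le: "\<forall>x y. h (x, y) \<le> \<phi> x + \<psi> y + t * cn n (x, y)"
    then have "integral\<^sup>L \<mu> \<phi> + integral\<^sup>L \<nu> \<psi> + t * V \<in> S (apply_bcontfun (Bcontfun h))"
      unfolding Bcontfun_apply[OF h] by (intro SI) auto
    then have "p (Bcontfun h) \<le> integral\<^sup>L \<mu> \<phi> + integral\<^sup>L \<nu> \<psi> + t * V"
      by (rule lower)
    then show "l (Bcontfun h) \<le> integral\<^sup>L \<mu> \<phi> + integral\<^sup>L \<nu> \<psi> + t * V"
      using l(2)[THEN le_funD, of "Bcontfun h"] by simp
  qed
qed

theorem exists_coupling_integral_le: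
  fixes \<mu> :: "'a::topological_space measure" and \<nu> :: "'b::topological_space measure"
    and cn :: "nat \<Rightarrow> 'a \<times> 'b \<Rightarrow> real" and V :: real
  assumes normal: "normal_space (euclidean :: 'a topology)" "normal_space (euclidean :: 'b topology)"
    and haus: "Hausdorff_space (euclidean :: 'a topology)" "Hausdorff_space (euclidean :: 'b topology)"
    and radon: "radon_prob \<mu>" "radon_prob \<nu>"
    and Cb: "\<And>n. cn n \<in> Cb" and cn_nonneg: "\<And>n z. 0 \<le> cn n z"
    and inc: "\<And>m n z. m \<le> n \<Longrightarrow> cn m z \<le> cn n z"
    and dual: "\<And>\<phi> \<psi> n. \<phi> \<in> Cb \<Longrightarrow> \<psi> \<in> Cb \<Longrightarrow> (\<And>x y. \<phi> x + \<psi> y \<le> cn n (x, y)) \<Longrightarrow>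
      integral\<^sup>L \<mu> \<phi> + integral\<^sup>L \<nu> \<psi> \<le> V"
  shows "\<exists>\<gamma>\<in>couplings \<mu> \<nu>. \<forall>n. (\<integral>\<^sup>+z. ennreal (cn n z) \<partial>\<gamma>) \<le> ennreal V"
proof -
  have prob: "prob_space \<mu>" "prob_space \<nu>" and sets: "sets \<mu> = sets borel" "sets \<nu> = sets borel"
    using radon by (auto simp: radon_prob_def)
  interpret M: prob_space \<mu> by fact
  interpret N: prob_space \<nu> by fact
  have sp: "space \<mu> = UNIV" "space \<nu> = UNIV"
    using sets_eq_imp_space_eq[OF sets(1)] sets_eq_imp_space_eq[OF sets(2)] by auto
  have int\<mu>: "integrable \<mu> \<phi>" if "\<phi> \<in> Cb" for \<phi>
    by (rule Cb_integrable[OF that M.finite_measure_axioms sets(1)])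
  have int\<nu>: "integrable \<nu> \<psi>" if "\<psi> \<in> Cb" for \<psi>
    by (rule Cb_integrable[OF that N.finite_measure_axioms sets(2)])
  obtain L :: "('a \<times> 'b \<Rightarrow> real) \<Rightarrow> real"
    where L: "\<forall>f\<in>Cb. \<forall>g\<in>Cb. L (\<lambda>x. f x + g x) = L f + L g"
      "\<forall>f\<in>Cb. \<forall>a. L (\<lambda>x. a * f x) = a * L f"
      "\<forall>h\<in>Cb. \<forall>\<phi>\<in>Cb. \<forall>\<psi>\<in>Cb. \<forall>t\<ge>0. \<forall>n.
        (\<forall>x y. h (x, y) \<le> \<phi> x + \<psi> y + t * cn n (x, y)) \<longrightarrow>
        L h \<le> integral\<^sup>L \<mu> \<phi> + integral\<^sup>L \<nu> \<psi> + t * V"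
    by (rule transport_functional[OF prob sets inc dual, THEN exE], assumption+) (elim conjE, rule that)
  have add: "L (\<lambda>x. f x + g x) = L f + L g" if "f \<in> Cb" "g \<in> Cb" for f g
    using L(1) that by simp
  have cmult: "L (\<lambda>x. a * f x) = a * L f" if "f \<in> Cb" for f a
    using L(2) that by simp
  have bound: "L h \<le> integral\<^sup>L \<mu> \<phi> + integral\<^sup>L \<nu> \<psi> + t * V"
    if "h \<in> Cb" "\<phi> \<in> Cb" "\<psi> \<in> Cb" "0 \<le> t" "\<And>x y. h (x, y) \<le> \<phi> x + \<psi> y + t * cn n (x, y)"
    for h \<phi> \<psi> t n
    using L(3)[rule_format, OF that] .
  have bound0: "L h \<le> integral\<^sup>L \<mu> \<phi> + integral\<^sup>L \<nu> \<psi>"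
    if "h \<in> Cb" "\<phi> \<in> Cb" "\<psi> \<in> Cb" "\<And>x y. h (x, y) \<le> \<phi> x + \<psi> y" for h \<phi> \<psi>
  proof -
    have "L h \<le> integral\<^sup>L \<mu> \<phi> + integral\<^sup>L \<nu> \<psi> + 0 * V"
      by (rule bound[of _ _ _ _ 0]) (simp_all add: that)
    then show ?thesis by simp
  qed
  \<comment> \<open>On a sum of two potentials the upper bound, used for \<open>f\<close> and for
    \<open>- f\<close>, determines \<open>L\<close> completely.\<close>
  have le_self: "L f \<le> integral\<^sup>L \<mu> \<phi> + integral\<^sup>L \<nu> \<psi>" "integral\<^sup>L \<mu> \<phi> + integral\<^sup>L \<nu> \<psi> \<le> L f"
    if "f \<in> Cb" "\<phi> \<in> Cb" "\<psi> \<in> Cb" "\<And>x y. f (x, y) = \<phi> x + \<psi> y" for f \<phi> \<psi>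
  proof -
    show "L f \<le> integral\<^sup>L \<mu> \<phi> + integral\<^sup>L \<nu> \<psi>"
      by (rule bound0) (simp_all add: that)
    have "L (\<lambda>z. (-1) * f z) \<le> integral\<^sup>L \<mu> (\<lambda>x. - \<phi> x) + integral\<^sup>L \<nu> (\<lambda>y. - \<psi> y)"
      by (rule bound0) (simp_all add: that Cb_uminus)
    then show "integral\<^sup>L \<mu> \<phi> + integral\<^sup>L \<nu> \<psi> \<le> L f"
      unfolding cmult[OF that(1)] by simp
  qed
  \<comment> \<open>The compact set is \<open>K1 \<times> K2\<close>. The mass outside each factor
    contributes \<open>e/4\<close>, and continuity of \<open>f\<close> near the rectangle
    contributes \<open>e/2\<close>.\<close>
  have tight: "\<exists>K. compact K \<and> (\<forall>f\<in>Cb. (\<forall>z\<in>K. f z \<le> 0) \<longrightarrow> (\<forall>z. f z \<le> 1) \<longrightarrow> L f \<le> e)"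
    if e: "0 < e" for e
  proof -
    have e4: "0 < e/4" using e by simp
    obtain K1 where K1: "compact K1" "closed K1" "measure \<mu> (- K1) \<le> e/4"
      by (rule radon_prob_tight[OF radon(1) haus(1) e4])
    obtain K2 where K2: "compact K2" "closed K2" "measure \<nu> (- K2) \<le> e/4"
      by (rule radon_prob_tight[OF radon(2) haus(2) e4])
    have "L f \<le> e" if f: "f \<in> Cb" "\<forall>z\<in>K1 \<times> K2. f z \<le> 0" "\<forall>z. f z \<le> 1" for f
    proof -
      have "open {z. f z < e/2}"
        using f(1) by (intro open_Collect_less continuous_intros Cb_continuous)
      moreover have "K1 \<times> K2 \<subseteq> {z. f z < e/2}"
      proof
        fix z assume "z \<in> K1 \<times> K2"
        with f(2) have "f z \<le> 0" by blast
        also have "0 < e/2" using e by simp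
        finally show "z \<in> {z. f z < e/2}" by simp
      qed
      \<comment> \<open>A rectangular neighbourhood is essential because the majorant must be a sum
        of functions of one variable: off \<open>U1 \<times> U2\<close> one of the two Urysohn
        functions equals 1 and dominates \<open>f\<close>.\<close>
      ultimately obtain U1 U2 where U: "open U1" "open U2" "K1 \<subseteq> U1" "K2 \<subseteq> U2"
        "U1 \<times> U2 \<subseteq> {z. f z < e/2}"
        using Wallace_theorem_prod_topology[of euclidean K1 euclidean K2 "{z. f z < e/2}"] K1(1) K2(1)
        by (metis compactin_euclidean_iff open_openin prod_topology_euclidean)
      have cl: "closed (- U1)" "K1 \<inter> - U1 = {}" "closed (- U2)" "K2 \<inter> - U2 = {}"
        using U by auto
      obtain \<phi> where \<phi>': "\<phi> \<in> Cb" "\<forall>x. 0 \<le> \<phi> x" "\<forall>x. \<phi> x \<le> 1"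
        "\<forall>x\<in>K1. \<phi> x = 0" "\<forall>x\<in>- U1. \<phi> x = (1::real)"
        by (rule Urysohn_Cb[OF normal(1) K1(2) cl(1,2)])
      note \<phi> = \<phi>'[rule_format]
      obtain \<psi> where \<psi>': "\<psi> \<in> Cb" "\<forall>x. 0 \<le> \<psi> x" "\<forall>x. \<psi> x \<le> 1"
        "\<forall>x\<in>K2. \<psi> x = 0" "\<forall>x\<in>- U2. \<psi> x = (1::real)"
        by (rule Urysohn_Cb[OF normal(2) K2(2) cl(3,4)])
      note \<psi> = \<psi>'[rule_format]
      have "L f \<le> integral\<^sup>L \<mu> (\<lambda>x. \<phi> x + e/2) + integral\<^sup>L \<nu> \<psi>"
      proof (rule bound0)
        fix x y
        show "f (x, y) \<le> \<phi> x + e/2 + \<psi> y"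
        proof (cases "(x, y) \<in> U1 \<times> U2")
          case True
          with U(5) have "f (x, y) < e/2" by blast
          with \<phi>(2)[of x] \<psi>(2)[of y] show ?thesis by simp
        next
          case False
          then have "\<phi> x = 1 \<or> \<psi> y = 1" using \<phi>(5) \<psi>(5) by auto
          moreover have "f (x, y) \<le> 1" using f(3) by simp
          ultimately show ?thesis using \<phi>(2)[of x] \<psi>(2)[of y] e by auto
        qed
      qed (intro f \<phi> \<psi> Cb_intros)+
      also have "integral\<^sup>L \<mu> (\<lambda>x. \<phi> x + e/2) = integral\<^sup>L \<mu> \<phi> + e/2"
        using int\<mu>[OF \<phi>(1)] by (simp add: M.prob_space)
      also have "integral\<^sup>L \<mu> \<phi> \<le> integral\<^sup>L \<mu> (indicator (- K1))"
        using \<phi> K1(2) by (intro integral_mono[OF int\<mu>[OF \<phi>(1)]])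
          (auto simp: indicator_def sets M.emeasure_eq_measure intro!: integrable_real_indicator)
      also have "integral\<^sup>L \<nu> \<psi> \<le> integral\<^sup>L \<nu> (indicator (- K2))"
        using \<psi> K2(2) by (intro integral_mono[OF int\<nu>[OF \<psi>(1)]])
          (auto simp: indicator_def sets N.emeasure_eq_measure intro!: integrable_real_indicator)
      finally show ?thesis using K1(3) K2(3) by (simp add: sp)
    qed
    then show ?thesis
      using compact_Times[OF K1(1) K2(1)] by (intro exI[of _ "K1 \<times> K2"]) blast
  qed
  have creg: "completely_regular_space (euclidean :: ('a \<times> 'b) topology)"
    unfolding prod_topology_euclidean[symmetric] completely_regular_space_prod_topology
    using normal haus by (simp add: normal_imp_completely_regular_space del: prod_topology_euclidean)
  have hausZ: "Hausdorff_space (euclidean :: ('a \<times> 'b) topology)"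
    unfolding prod_topology_euclidean[symmetric] Hausdorff_space_prod_topology
    using haus by (simp del: prod_topology_euclidean)
  interpret tight_functional L
  proof
    fix f g :: "'a \<times> 'b \<Rightarrow> real" assume fg: "f \<in> Cb" "g \<in> Cb" "\<And>x. f x \<le> g x"
    \<comment> \<open>Positivity is the upper bound with both potentials zero.\<close>
    have "L (\<lambda>z. f z + (-1) * g z) \<le> 0"
      by (rule order_trans[OF bound0[of _ "\<lambda>_. 0" "\<lambda>_. 0"]]) (auto intro!: Cb_diff Cb_const fg)
    then show "L f \<le> L g"
      using add[OF fg(1) Cb_cmult[OF fg(2)], of "-1"] cmult[OF fg(2), of "-1"] by simp
  next
    show "L (\<lambda>_. 1) = 1"
      using le_self[of "\<lambda>_. 1" "\<lambda>_. 1" "\<lambda>_. 0"] by (simp add: Cb_const M.prob_space)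
  qed (use add cmult tight Hausdorff_compact_closed[OF hausZ] completely_regular_separation[OF creg] in auto)
  let ?\<gamma> = rep_measure
  \<comment> \<open>A Urysohn function \<open>\<phi>\<close> between \<open>K\<close> and
    \<open>U\<close> links the two measures: its integral dominates the mass of \<open>K\<close>,
    equals the value of \<open>L\<close> on its lift, and this value is at most the content of the
    cylinder over \<open>U\<close>.\<close>
  have "distr ?\<gamma> borel fst = \<mu>"
  proof (rule radon_distr_eqI[OF radon_prob_rep_measure radon(1) haus(1) continuous_on_fst[OF continuous_on_id]])
    fix U K :: "'a set" assume U: "open U" and K: "compact K" "K \<subseteq> U"
    have clK: "closed K" by (rule Hausdorff_compact_closed[OF haus(1) K(1)])
    have disj: "- U \<inter> K = {}" using K(2) by blast
    obtain \<phi> where \<phi>': "\<phi> \<in> Cb" "\<forall>x. 0 \<le> \<phi> x" "\<forall>x. \<phi> x \<le> 1"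
      "\<forall>x\<in>- U. \<phi> x = 0" "\<forall>x\<in>K. \<phi> x = (1::real)"
      by (rule Urysohn_Cb[OF normal(1) closed_Compl[OF U] clK disj])
    note \<phi> = \<phi>'[rule_format]
    have \<phi>L: "(\<lambda>z. \<phi> (fst z)) \<in> Cb"
      by (rule Cb_comp[OF \<phi>(1) continuous_on_fst[OF continuous_on_id]])
    have "measure \<mu> K = integral\<^sup>L \<mu> (indicator K)" by (simp add: sp)
    also have "\<dots> \<le> integral\<^sup>L \<mu> \<phi>"
      using \<phi> clK by (intro integral_mono[OF _ int\<mu>[OF \<phi>(1)]])
        (auto simp: indicator_def sets M.emeasure_eq_measure intro!: integrable_real_indicator)
    also have "\<dots> \<le> L (\<lambda>z. \<phi> (fst z))"
      using le_self(2)[OF \<phi>L \<phi>(1) Cb_const, of 0] by simp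
    finally have "emeasure \<mu> K \<le> ennreal (L (\<lambda>z. \<phi> (fst z)))"
      by (simp add: M.emeasure_eq_measure ennreal_leI)
    also have "\<dots> \<le> open_content (fst -` U)"
      using \<phi> \<phi>L by (intro open_content_upper belowI) auto
    also have "\<dots> = emeasure ?\<gamma> (fst -` U)"
      using U by (intro emeasure_rep_measure_open[symmetric] open_vimage_fst)
    finally show "emeasure \<mu> K \<le> emeasure ?\<gamma> (fst -` U)" .
  qed
  moreover have "distr ?\<gamma> borel snd = \<nu>"
  proof (rule radon_distr_eqI[OF radon_prob_rep_measure radon(2) haus(2) continuous_on_snd[OF continuous_on_id]])
    fix U K :: "'b set" assume U: "open U" and K: "compact K" "K \<subseteq> U"
    have clK: "closed K" by (rule Hausdorff_compact_closed[OF haus(2) K(1)])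
    have disj: "- U \<inter> K = {}" using K(2) by blast
    obtain \<psi> where \<psi>': "\<psi> \<in> Cb" "\<forall>x. 0 \<le> \<psi> x" "\<forall>x. \<psi> x \<le> 1"
      "\<forall>x\<in>- U. \<psi> x = 0" "\<forall>x\<in>K. \<psi> x = (1::real)"
      by (rule Urysohn_Cb[OF normal(2) closed_Compl[OF U] clK disj])
    note \<psi> = \<psi>'[rule_format]
    have \<psi>L: "(\<lambda>z. \<psi> (snd z)) \<in> Cb"
      by (rule Cb_comp[OF \<psi>(1) continuous_on_snd[OF continuous_on_id]])
    have "measure \<nu> K = integral\<^sup>L \<nu> (indicator K)" by (simp add: sp)
    also have "\<dots> \<le> integral\<^sup>L \<nu> \<psi>"
      using \<psi> clK by (intro integral_mono[OF _ int\<nu>[OF \<psi>(1)]])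
        (auto simp: indicator_def sets N.emeasure_eq_measure intro!: integrable_real_indicator)
    also have "\<dots> \<le> L (\<lambda>z. \<psi> (snd z))"
      using le_self(2)[OF \<psi>L Cb_const \<psi>(1), of 0] by simp
    finally have "emeasure \<nu> K \<le> ennreal (L (\<lambda>z. \<psi> (snd z)))"
      by (simp add: N.emeasure_eq_measure ennreal_leI)
    also have "\<dots> \<le> open_content (snd -` U)"
      using \<psi> \<psi>L by (intro open_content_upper belowI) auto
    also have "\<dots> = emeasure ?\<gamma> (snd -` U)"
      using U by (intro emeasure_rep_measure_open[symmetric] open_vimage_snd)
    finally show "emeasure \<nu> K \<le> emeasure ?\<gamma> (snd -` U)" .
  qed
  ultimately have "?\<gamma> \<in> couplings \<mu> \<nu>"
    using radon_prob_rep_measure by (simp add: couplings_def)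
  moreover have "(\<integral>\<^sup>+z. ennreal (cn n z) \<partial>?\<gamma>) \<le> ennreal V" for n
  proof -
    \<comment> \<open>Zero potentials and \<open>t = 1\<close> extract the cost constraint.\<close>
    have "L (cn n) \<le> V"
      by (rule order_trans[OF bound[of _ "\<lambda>_. 0" "\<lambda>_. 0" 1 n]]) (simp_all add: Cb Cb_const)
    then show ?thesis
      using nn_integral_rep_measure_le[OF Cb cn_nonneg, of n] by (meson ennreal_leI order_trans)
  qed
  ultimately show ?thesis by blast
qed

lemma eintegral_nonneg:
  assumes "\<And>z. 0 \<le> g z"
  shows "eintegral M g = enn2ereal (\<integral>\<^sup>+z. e2ennreal (g z) \<partial>M)"
proof -
  have "e2ennreal (- g z) = 0" for z
    using assms[of z] by (simp add: e2ennreal_neg)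
  then show ?thesis by (simp add: eintegral_def zero_ennreal.rep_eq)
qed

lemma weak_duality:
  assumes c: "\<And>z. 0 \<le> c z" and \<gamma>: "\<gamma> \<in> couplings \<mu> \<nu>"
    and \<phi>: "\<phi> \<in> Cb" and \<psi>: "\<psi> \<in> Cb" and le: "\<And>x y. ereal (\<phi> x + \<psi> y) \<le> c (x, y)"
  shows "ereal (integral\<^sup>L \<mu> \<phi> + integral\<^sup>L \<nu> \<psi>) \<le> eintegral \<gamma> c"
proof -
  have rad: "radon_prob \<gamma>" and dist: "distr \<gamma> borel fst = \<mu>" "distr \<gamma> borel snd = \<nu>"
    using \<gamma> by (auto simp: couplings_def)
  interpret prob_space \<gamma> using rad by (simp add: radon_prob_def)
  have sets: "sets \<gamma> = sets borel" using rad by (simp add: radon_prob_def)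
  \<comment> \<open>Measurability comes from continuity, as \<open>\<gamma>\<close> lives on the
    Borel sets of the product topology, not on the product sigma-algebra.\<close>
  have fst: "fst \<in> measurable \<gamma> borel" and snd: "snd \<in> measurable \<gamma> borel"
    using borel_measurable_continuous_onI[OF continuous_on_fst[OF continuous_on_id]]
      borel_measurable_continuous_onI[OF continuous_on_snd[OF continuous_on_id]] sets
    by (metis measurable_cong_sets)+
  have C1: "(\<lambda>z. \<phi> (fst z)) \<in> Cb" by (rule Cb_comp[OF \<phi> continuous_on_fst[OF continuous_on_id]])
  have C2: "(\<lambda>z. \<psi> (snd z)) \<in> Cb" by (rule Cb_comp[OF \<psi> continuous_on_snd[OF continuous_on_id]])
  \<comment> \<open>The integral of \<open>c\<close> is a nonnegative one, while the sum of
    potentials may be negative. Its positive part still lies below \<open>c\<close>, because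
    \<open>c\<close> is nonnegative.\<close>
  define h where "h z = max 0 (\<phi> (fst z) + \<psi> (snd z))" for z
  have h: "h \<in> Cb" unfolding h_def by (intro Cb_intros C1 C2)
  note int = Cb_integrable[OF _ finite_measure_axioms sets]
  have "integral\<^sup>L \<mu> \<phi> + integral\<^sup>L \<nu> \<psi> = (\<integral>z. \<phi> (fst z) \<partial>\<gamma>) + (\<integral>z. \<psi> (snd z) \<partial>\<gamma>)"
    unfolding dist[symmetric] using \<phi> \<psi>
    by (simp add: integral_distr[OF fst] integral_distr[OF snd] Cb_borel_measurable)
  also have "\<dots> = (\<integral>z. \<phi> (fst z) + \<psi> (snd z) \<partial>\<gamma>)"
    by (rule Bochner_Integration.integral_add[symmetric]) (intro int C1 C2)+
  also have "\<dots> \<le> integral\<^sup>L \<gamma> h"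
    by (intro integral_mono int Cb_intros C1 C2 h) (simp add: h_def)
  finally have "ereal (integral\<^sup>L \<mu> \<phi> + integral\<^sup>L \<nu> \<psi>) \<le> ereal (integral\<^sup>L \<gamma> h)" by simp
  also have "\<dots> = enn2ereal (ennreal (integral\<^sup>L \<gamma> h))"
    by (simp add: enn2ereal_ennreal h_def)
  also have "ennreal (integral\<^sup>L \<gamma> h) = (\<integral>\<^sup>+z. ennreal (h z) \<partial>\<gamma>)"
    by (rule nn_integral_eq_integral[symmetric]) (auto intro: int h simp: h_def)
  also have "\<dots> \<le> (\<integral>\<^sup>+z. e2ennreal (c z) \<partial>\<gamma>)"
  proof (intro nn_integral_mono)
    fix z
    have "ereal (h z) \<le> c z"
      using le[of "fst z" "snd z"] c[of z] by (simp add: h_def max_def zero_ereal_def)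
    then show "ennreal (h z) \<le> e2ennreal (c z)"
      by (metis e2ennreal_ereal e2ennreal_mono)
  qed
  finally show ?thesis
    by (simp add: eintegral_nonneg[OF c] less_eq_ennreal.rep_eq)
qed

theorem mainTheorem13:
  fixes \<mu> :: "'a::topological_space measure" and \<nu> :: "'b::topological_space measure"
    and c :: "'a \<times> 'b \<Rightarrow> ereal" and cn :: "nat \<Rightarrow> 'a \<times> 'b \<Rightarrow> real"
  assumes "perfectly_normal (euclidean :: 'a topology)" "Hausdorff_space (euclidean :: 'a topology)"
    and "perfectly_normal (euclidean :: 'b topology)" "Hausdorff_space (euclidean :: 'b topology)"
    and "radon_prob \<mu>" "radon_prob \<nu>"
    and "c \<in> lsc_bi"
    and "vmin_KP \<mu> \<nu> c < \<infinity>"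
    and "\<And>z. (\<lambda>n. ereal (cn n z)) \<longlonglongrightarrow> c z"
    and "\<And>n z. cn n z \<le> cn (Suc n) z"
    and "\<And>n. bounded (range (cn n))"
    and "\<And>n z. 0 \<le> cn n z"
    and "\<And>n. property_H (cn n)"
  shows "vmax_DP \<mu> \<nu> c = vmin_KP \<mu> \<nu> c"
proof (rule antisym)
  have inc: "cn m z \<le> cn n z" if "m \<le> n" for m n z
    by (rule lift_Suc_mono_le[of "\<lambda>n. cn n z", OF assms(10) that])
  have sup: "c z = (SUP n. ereal (cn n z))" for z
    using LIMSEQ_unique[OF assms(9) LIMSEQ_SUP[of "\<lambda>n. ereal (cn n z)"]] inc
    by (auto simp: incseq_def)
  have cn_le: "ereal (cn n z) \<le> c z" for n z
    unfolding sup by (rule SUP_upper) simp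
  have c: "0 \<le> c z" for z
    using order_trans[OF _ cn_le[of 0 z], of 0] assms(12)[of 0 z] by simp
  have Cb: "cn n \<in> Cb" for n
    using assms(11,13) by (simp add: Cb_def property_H_continuous)
  show le: "vmax_DP \<mu> \<nu> c \<le> vmin_KP \<mu> \<nu> c"
    unfolding vmax_DP_def vmin_KP_def
    by (intro Sup_least INF_greatest) (auto intro!: weak_duality[OF c])
  have dual: "ereal (integral\<^sup>L \<mu> \<phi> + integral\<^sup>L \<nu> \<psi>) \<le> vmax_DP \<mu> \<nu> c"
    if "\<phi> \<in> Cb" "\<psi> \<in> Cb" "\<And>x y. ereal (\<phi> x + \<psi> y) \<le> c (x, y)" for \<phi> \<psi>
    unfolding vmax_DP_def using that by (intro Sup_upper) blast
  \<comment> \<open>Zero potentials are admissible since \<open>c\<close> is nonnegative. With weak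
    duality and the finite primal value this makes the dual value a real \<open>V\<close>, and its
    sign ensures that \<open>ennreal V\<close> does not truncate it.\<close>
  have V0: "0 \<le> vmax_DP \<mu> \<nu> c"
    using dual[of "\<lambda>_. 0" "\<lambda>_. 0"] c by (simp add: Cb_const zero_ereal_def)
  then obtain V where V: "vmax_DP \<mu> \<nu> c = ereal V"
    using le assms(8) by (cases "vmax_DP \<mu> \<nu> c") auto
  have "normal_space (euclidean :: 'a topology)" "normal_space (euclidean :: 'b topology)"
    using assms(1,3) by (auto simp: perfectly_normal_def)
  then have "\<exists>\<gamma>\<in>couplings \<mu> \<nu>. \<forall>n. (\<integral>\<^sup>+z. ennreal (cn n z) \<partial>\<gamma>) \<le> ennreal V"
  proof (rule exists_coupling_integral_le[OF _ _ assms(2,4,5,6) Cb assms(12) inc])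
    fix \<phi> :: "'a \<Rightarrow> real" and \<psi> :: "'b \<Rightarrow> real" and n
    assume Cb: "\<phi> \<in> Cb" "\<psi> \<in> Cb" and le: "\<And>x y. \<phi> x + \<psi> y \<le> cn n (x, y)"
    have "ereal (\<phi> x + \<psi> y) \<le> c (x, y)" for x y
      using le by (intro order_trans[OF _ cn_le[of n]]) simp
    from dual[OF Cb this] show "integral\<^sup>L \<mu> \<phi> + integral\<^sup>L \<nu> \<psi> \<le> V"
      by (simp add: V)
  qed
  then obtain \<gamma> where \<gamma>: "\<gamma> \<in> couplings \<mu> \<nu>" "\<And>n. (\<integral>\<^sup>+z. ennreal (cn n z) \<partial>\<gamma>) \<le> ennreal V"
    by blast
  have sets: "sets \<gamma> = sets borel" using \<gamma>(1) by (simp add: couplings_def radon_prob_def)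
  \<comment> \<open>Both sides are limits of the same sequence: one by monotonicity, the other by
    continuity of \<open>e2ennreal\<close>.\<close>
  have "e2ennreal (c z) = (SUP n. ennreal (cn n z))" for z
  proof (rule LIMSEQ_unique)
    show "(\<lambda>n. ennreal (cn n z)) \<longlonglongrightarrow> (SUP n. ennreal (cn n z))"
      by (intro LIMSEQ_SUP) (auto simp: incseq_def intro: ennreal_leI inc)
    show "(\<lambda>n. ennreal (cn n z)) \<longlonglongrightarrow> e2ennreal (c z)"
      using tendsto_e2ennrealI[OF assms(9)[of z]] by (simp add: e2ennreal_ereal)
  qed
  then have "(\<integral>\<^sup>+z. e2ennreal (c z) \<partial>\<gamma>) = (SUP n. \<integral>\<^sup>+z. ennreal (cn n z) \<partial>\<gamma>)"
    using Cb_borel_measurable[OF Cb sets]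
    by (simp, intro nn_integral_monotone_convergence_SUP)
      (auto simp: incseq_def le_fun_def intro: ennreal_leI inc)
  also have "\<dots> \<le> ennreal V" by (intro SUP_least \<gamma>)
  finally have "eintegral \<gamma> c \<le> enn2ereal (ennreal V)"
    by (simp add: eintegral_nonneg[OF c] less_eq_ennreal.rep_eq)
  also have "\<dots> = vmax_DP \<mu> \<nu> c" using V V0 by (simp add: enn2ereal_ennreal)
  finally show "vmin_KP \<mu> \<nu> c \<le> vmax_DP \<mu> \<nu> c"
    unfolding vmin_KP_def using \<gamma>(1) by (meson INF_lower order_trans)
qed

end
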